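(* Fix $d>5$ and consider excited random walk on $\mathbb{Z}^d$ with excitement parameter $\beta\in[0,1]$. There exists $\beta_0=\beta_0(d)>0$ such that for all $\beta\le\beta_0$ there exists $\theta=(\theta_1(\beta,d),0,\dots,0)$ such that, as $n\to\infty$: (a) $\mathbb{E}_\beta[\omega_n]=\theta n\,\Big[1+O\Big(\dfrac{\log n}{n^{1\wedge\frac{d-5}{2}}}\Big)\Big]$; (b) $\dfrac{\omega_n}{n}\to\theta$ in probability under $\mathbb{Q}_\beta$.
   Context: Excited random walk (ERW) with parameter $\beta\in[0,1]$ is the nearest-neighbour walk on $\mathbb{Z}^d$ started at $\omega_0=0$ such that, given the history $\vec\omega_i=(x_0,\dots,x_i)$, the probability of stepping from $x_i$ to $x_{i+1}$ is $p_0(x_{i+1}-x_i)$ if $x_i=x_j$ for some $0\le j\le i-1$, and $p_\beta(x_{i+1}-x_i)$ otherwise (first visit to $x_i$, including the starting point at time $0$). Here $p_0(x)=\frac1{2d}I_{\{|x|=1\}}$, $p_\beta(x)=\frac{1+\beta e_1\cdot x}{2d}I_{\{|x|=1\}}$ and $e_1=(1,0,\dots,0)$. $\mathbb{Q}_\beta$ denotes its law and $\mathbb{E}_\beta$ its expectation; $a\wedge b=\min(a,b)$. For a vector $v$, $v_n=vn[1+O(\epsilon_n)]$ means $|v_n-vn|=O(n\epsilon_n)$ as $n\to\infty$. *)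

theory Defs
  imports "HOL-Probability.Probability"
begin

text \<open>
  \<open>d = CARD('d)\<close>.  The class \<open>one\<close> is purely syntactic: it only serves to name the first
  coordinate direction, as \<open>1 :: 'd\<close>, so that \<open>x $ 1\<close> is the first component of \<open>x\<close>.
\<close>

definition to_real_vec :: "int ^ 'd \<Rightarrow> real ^ 'd" where
  "to_real_vec x = (\<chi> i. real_of_int (x $ i))"

definition e1 :: "real ^ 'd::{finite,one}" where
  "e1 = axis 1 1"

definition step_prob :: "real \<Rightarrow> int ^ 'd::{finite,one} \<Rightarrow> real" where
  "step_prob \<beta> x =
     (if norm (to_real_vec x) = 1 then (1 + \<beta> * (e1 \<bullet> to_real_vec x)) / (2 * real CARD('d)) else 0)"

definition erw_step_prob ::
    "real \<Rightarrow> nat \<Rightarrow> (nat \<Rightarrow> int ^ 'd::{finite,one}) \<Rightarrow> int ^ 'd::{finite,one} \<Rightarrow> real" where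
  "erw_step_prob \<beta> i \<omega> y =
     (if \<exists>j<i. \<omega> i = \<omega> j then step_prob 0 (y - \<omega> i) else step_prob \<beta> (y - \<omega> i))"

text \<open>
  \<open>erw_kernel \<beta> n \<omega>\<close> is the conditional law of the position at time \<open>n\<close> given the
  positions \<open>\<omega> 0, \<dots>, \<omega> (n - 1)\<close>.
\<close>

definition erw_kernel ::
    "real \<Rightarrow> nat \<Rightarrow> (nat \<Rightarrow> int ^ 'd::{finite,one}) \<Rightarrow> (int ^ 'd::{finite,one}) measure" where
  "erw_kernel \<beta> n \<omega> =
     (case n of
        0 \<Rightarrow> return (count_space UNIV) 0
      | Suc i \<Rightarrow> density (count_space UNIV) (\<lambda>y. ennreal (erw_step_prob \<beta> i \<omega> y)))"

text \<open>
  The law on path space given by the Ionescu--Tulcea theorem.  It is meaningful for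
  \<open>0 \<le> \<beta> \<le> 1\<close>, where the kernels are probability measures; \<open>emeasure_erw_law_cylinder\<close>
  below gives its finite-dimensional distributions.
\<close>

definition erw_law :: "real \<Rightarrow> (nat \<Rightarrow> int ^ 'd::{finite,one}) measure" where
  "erw_law \<beta> =
     projective_family.lim UNIV (Ionescu_Tulcea.CI (erw_kernel \<beta>) (\<lambda>_. count_space UNIV))
       (\<lambda>_. count_space UNIV)"

lemma norm_axis_1:
  "norm (axis i c :: real ^ 'd) = \<bar>c\<bar>"
  by (simp add: norm_eq_sqrt_inner inner_axis_axis)

lemma norm_to_real_vec_eq_1_iff:
  fixes x :: "int ^ 'd::finite"
  shows "norm (to_real_vec x) = 1 \<longleftrightarrow> x \<in> (\<lambda>(i, s). axis i s) ` (UNIV \<times> {1, -1})"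
proof
  assume "norm (to_real_vec x) = 1"
  then have "(\<Sum>i\<in>UNIV. (real_of_int (x $ i))\<^sup>2) = 1"
    by (simp add: norm_eq_1 to_real_vec_def inner_vec_def power2_eq_square)
  then have "real_of_int (\<Sum>i\<in>UNIV. (x $ i)\<^sup>2) = 1" by simp
  then have s: "(\<Sum>i\<in>UNIV. (x $ i)\<^sup>2) = 1" by linarith
  then obtain k where k: "x $ k \<noteq> 0" by (metis sum.neutral zero_eq_power2 zero_neq_one)
  have s': "(x $ k)\<^sup>2 + (\<Sum>i\<in>UNIV - {k}. (x $ i)\<^sup>2) = 1"
    using s by (simp add: sum.remove[of UNIV k])
  have p: "(\<Sum>i\<in>UNIV - {k}. (x $ i)\<^sup>2) \<ge> 0" by (simp add: sum_nonneg)
  have "(x $ k)\<^sup>2 > 0" using k by simp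
  with s' p have k1: "(x $ k)\<^sup>2 = 1" and "(\<Sum>i\<in>UNIV - {k}. (x $ i)\<^sup>2) = 0" by linarith+
  then have z: "x $ i = 0" if "i \<noteq> k" for i
    using that by (simp add: sum_nonneg_eq_0_iff)
  have "x = axis k (x $ k)"
    using z by (auto simp: vec_eq_iff axis_def)
  moreover have "x $ k = 1 \<or> x $ k = -1" using k1 by (simp add: power2_eq_1_iff)
  ultimately show "x \<in> (\<lambda>(i, s). axis i s) ` (UNIV \<times> {1, -1})"
    by (auto simp: image_iff)
next
  have "to_real_vec (axis i s) = axis i (real_of_int s)" for i :: 'd and s
    by (auto simp: to_real_vec_def vec_eq_iff axis_def)
  then show "x \<in> (\<lambda>(i, s). axis i s) ` (UNIV \<times> {1, -1}) \<Longrightarrow> norm (to_real_vec x) = 1"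
    by (auto simp: norm_axis_1)
qed

lemma step_prob_nonneg:
  fixes x :: "int ^ 'd::{finite,one}"
  assumes "0 \<le> \<beta>" "\<beta> \<le> 1"
  shows "0 \<le> step_prob \<beta> x"
proof (cases "norm (to_real_vec x) = 1")
  case True
  have "\<bar>(e1 :: real ^ 'd::{finite,one}) \<bullet> to_real_vec x\<bar> \<le> norm (e1 :: real ^ 'd::{finite,one}) * norm (to_real_vec x)"
    by (rule Cauchy_Schwarz_ineq2)
  then have *: "\<bar>(e1 :: real ^ 'd::{finite,one}) \<bullet> to_real_vec x\<bar> \<le> 1"
    using True by (simp add: e1_def norm_axis_1)
  have "\<bar>\<beta> * ((e1 :: real ^ 'd::{finite,one}) \<bullet> to_real_vec x)\<bar> \<le> 1 * 1"
    unfolding abs_mult using assms * by (intro mult_mono) auto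
  then show ?thesis by (auto simp: step_prob_def)
qed (simp add: step_prob_def)

lemma nn_integral_step_prob:
  fixes x :: "int ^ 'd::{finite,one}"
  assumes "0 \<le> \<beta>" "\<beta> \<le> 1"
  shows "(\<integral>\<^sup>+y. ennreal (step_prob \<beta> (y - x)) \<partial>count_space UNIV) = 1"
proof -
  define N where "N = {y :: int ^ 'd::{finite,one}. norm (to_real_vec y) = 1}"
  have N: "N = (\<lambda>(i, s). axis i s) ` (UNIV \<times> {1, -1})"
    unfolding N_def using norm_to_real_vec_eq_1_iff by blast
  have inj: "inj_on (\<lambda>(i :: 'd, s :: int). axis i s) (UNIV \<times> {1, -1})"
    by (auto simp: inj_on_def axis_eq_axis)
  have fin: "finite N" unfolding N by simp
  have tr: "to_real_vec (axis i s) = axis i (real_of_int s)" for i :: 'd and s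
    by (auto simp: to_real_vec_def vec_eq_iff axis_def)
  have "(\<integral>\<^sup>+y. ennreal (step_prob \<beta> (y - x)) \<partial>count_space UNIV) =
        (\<integral>\<^sup>+y. ennreal (step_prob \<beta> (y :: int ^ 'd::{finite,one})) \<partial>count_space UNIV)"
    by (rule nn_integral_bij_count_space[where f = "\<lambda>y. ennreal (step_prob \<beta> y)" and g = "\<lambda>y. y - x"])
       (auto intro!: bij_betwI[where g = "\<lambda>y. y + x"])
  also have "\<dots> = (\<Sum>y\<in>N. ennreal (step_prob \<beta> y))"
    by (rule nn_integral_count_space'[OF fin]) (auto simp: N_def step_prob_def)
  also have "\<dots> = ennreal (\<Sum>y\<in>N. step_prob \<beta> y)"
    by (simp add: step_prob_nonneg assms)
  also have "(\<Sum>y\<in>N. step_prob \<beta> y) =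
      (\<Sum>y\<in>N. (1 + \<beta> * ((e1 :: real ^ 'd::{finite,one}) \<bullet> to_real_vec y)) / (2 * real CARD('d)))"
    by (auto simp: N_def step_prob_def intro!: sum.cong)
  also have "\<dots> = (\<Sum>(i :: 'd, s :: int)\<in>UNIV \<times> {1, -1}.
      (1 + \<beta> * (e1 \<bullet> axis i (real_of_int s))) / (2 * real CARD('d)))"
    unfolding N by (subst sum.reindex[OF inj]) (simp add: case_prod_unfold tr)
  also have "\<dots> = (\<Sum>i::'d\<in>UNIV. 1 / real CARD('d))"
  proof (subst sum.cartesian_product[symmetric], rule sum.cong)
    fix i :: 'd
    define c where "c = (e1 :: real ^ 'd::{finite,one}) \<bullet> axis i 1"
    have "(e1 :: real ^ 'd::{finite,one}) \<bullet> axis i (real_of_int s) = c * real_of_int s" for s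
      by (simp add: c_def e1_def inner_axis_axis)
    then show "(\<Sum>s\<in>{1, -1 :: int}. (1 + \<beta> * ((e1 :: real ^ 'd::{finite,one}) \<bullet>
        axis i (real_of_int s))) / (2 * real CARD('d))) = 1 / real CARD('d)"
      by (simp add: add_divide_distrib[symmetric])
  qed simp
  also have "\<dots> = 1" by simp
  finally show ?thesis by simp
qed

lemma Ionescu_Tulcea_erw_kernel:
  assumes "0 \<le> \<beta>" "\<beta> \<le> 1"
  shows "Ionescu_Tulcea (erw_kernel \<beta> :: nat \<Rightarrow> (nat \<Rightarrow> int ^ 'd::{finite,one}) \<Rightarrow> _)
           (\<lambda>_. count_space UNIV)"
proof (rule Ionescu_Tulcea.intro)
  have *: "prob_space (erw_kernel \<beta> n \<omega>)" for n and \<omega> :: "nat \<Rightarrow> int ^ 'd::{finite,one}"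
  proof (cases n)
    case 0
    then show ?thesis by (simp add: erw_kernel_def prob_space_return)
  next
    case (Suc i)
    have "(\<integral>\<^sup>+y. ennreal (erw_step_prob \<beta> i \<omega> y) \<partial>count_space UNIV) = 1"
    proof -
      define b where "b = (if \<exists>j<i. \<omega> i = \<omega> j then 0 else \<beta>)"
      have "erw_step_prob \<beta> i \<omega> y = step_prob b (y - \<omega> i)" for y
        by (auto simp: erw_step_prob_def b_def)
      moreover have "0 \<le> b" "b \<le> 1" using assms by (auto simp: b_def)
      ultimately show ?thesis using nn_integral_step_prob[of b "\<omega> i"] by simp
    qed
    then show ?thesis
      using Suc by (intro prob_spaceI) (simp add: erw_kernel_def emeasure_density)
  qed
  then show "prob_space (erw_kernel \<beta> n \<omega>)" for n and \<omega> :: "nat \<Rightarrow> int ^ 'd::{finite,one}" .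
  fix n :: nat
  have "PiM {0..<n} (\<lambda>_. count_space (UNIV :: (int ^ 'd::{finite,one}) set)) =
        count_space (PiE {0..<n} (\<lambda>_. UNIV))"
    by (rule count_space_PiM_finite) auto
  then show "erw_kernel \<beta> n \<in> PiM {0..<n} (\<lambda>_. count_space (UNIV :: (int ^ 'd::{finite,one}) set)) \<rightarrow>\<^sub>M
               subprob_algebra (count_space UNIV)"
    using * by (auto simp: space_subprob_algebra erw_kernel_def prob_space_imp_subprob_space
        split: nat.split)
qed

lemma prob_space_erw_law:
  assumes "0 \<le> \<beta>" "\<beta> \<le> 1"
  shows "prob_space (erw_law \<beta> :: (nat \<Rightarrow> int ^ 'd::{finite,one}) measure)"
proof -
  interpret Ionescu_Tulcea "erw_kernel \<beta> :: nat \<Rightarrow> (nat \<Rightarrow> int ^ 'd::{finite,one}) \<Rightarrow> _" "\<lambda>_. count_space UNIV"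
    by (rule Ionescu_Tulcea_erw_kernel[OF assms])
  have "emeasure PF.lim (PF.emb UNIV {} {\<lambda>_. undefined}) = emeasure (CI {}) {\<lambda>_. undefined}"
    by (rule lim) (auto simp: PiM_empty)
  moreover have "emeasure (CI {}) (space (CI {})) = 1"
    by (intro prob_space.emeasure_space_1 PF.prob_space_P) auto
  moreover have "(\<lambda>x. restrict x {}) -` {\<lambda>_. undefined} = (UNIV :: (nat \<Rightarrow> int ^ 'd::{finite,one}) set)"
    by (auto simp: restrict_def)
  ultimately show ?thesis
    by (intro prob_spaceI)
       (simp add: erw_law_def PF.space_P PiM_empty space_PiM prod_emb_def PiE_def)
qed

lemma emeasure_erw_law_cylinder:
  fixes x :: "nat \<Rightarrow> int ^ 'd::{finite,one}"
  assumes "0 \<le> \<beta>" "\<beta> \<le> 1"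
  shows "emeasure (erw_law \<beta>) {\<omega>. \<forall>i\<le>n. \<omega> i = x i} =
    (if x 0 = 0 then (\<Prod>i<n. ennreal (erw_step_prob \<beta> i x (x (Suc i)))) else 0)"
proof -
  let ?M = "\<lambda>_::nat. count_space (UNIV :: (int ^ 'd::{finite,one}) set)"
  interpret Ionescu_Tulcea "erw_kernel \<beta> :: nat \<Rightarrow> (nat \<Rightarrow> int ^ 'd::{finite,one}) \<Rightarrow> _" ?M
    by (rule Ionescu_Tulcea_erw_kernel[OF assms])
  define r where "r m = restrict x {0..<m}" for m
  have sing: "{r m} \<in> sets (PiM {0..<m} ?M)" for m
  proof -
    have "PiM {0..<m} ?M = count_space (PiE {0..<m} (\<lambda>_. UNIV))"
      by (rule count_space_PiM_finite) auto
    then show ?thesis by (simp add: r_def)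
  qed
  have ker: "erw_kernel \<beta> m (r m) = erw_kernel \<beta> m x" for m
    by (cases m) (auto simp: erw_kernel_def erw_step_prob_def r_def fun_eq_iff cong: conj_cong
        intro!: arg_cong[where f = "density (count_space UNIV)"])
  have C_step: "emeasure (C 0 (Suc m) (\<lambda>_. undefined)) {r (Suc m)} =
      emeasure (erw_kernel \<beta> m x) {x m} * emeasure (C 0 m (\<lambda>_. undefined)) {r m}" for m
  proof -
    have "emeasure (C 0 (Suc m) (\<lambda>_. undefined)) {r (Suc m)} =
        (\<integral>\<^sup>+\<omega>. emeasure (eP m \<omega>) {r (Suc m)} \<partial>C 0 m (\<lambda>_. undefined))"
      using sing[of "Suc m"] measurable_eP[of m]
      by (simp, subst emeasure_bind[where N = "PiM {0..<Suc m} ?M"])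
         (auto simp: space_C measurable_cong_sets[OF sets_C refl] space_PiM)
    also have "\<dots> = (\<integral>\<^sup>+\<omega>. emeasure (erw_kernel \<beta> m x) {x m} * indicator {r m} \<omega>
        \<partial>C 0 m (\<lambda>_. undefined))"
    proof (rule nn_integral_cong)
      fix \<omega> assume "\<omega> \<in> space (C 0 m (\<lambda>_. undefined))"
      then have \<omega>: "\<omega> \<in> space (PiM {0..<m} ?M)" by (simp add: space_C space_PiM)
      then have ext: "\<omega> \<in> extensional {0..<m}" by (simp add: space_PiM PiE_def)
      have "(\<lambda>y. fun_upd \<omega> m y) -` {r (Suc m)} = (if \<omega> = r m then {x m} else {})"
      proof -
        have "fun_upd \<omega> m y = r (Suc m) \<longleftrightarrow> \<omega> = r m \<and> y = x m" for y
        proof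
          assume eq: "fun_upd \<omega> m y = r (Suc m)"
          have "\<omega> k = r m k" for k
            using fun_cong[OF eq, of k] ext
            by (cases "k < m") (auto simp: r_def extensional_def fun_upd_def split: if_splits)
          moreover have "y = x m" using fun_cong[OF eq, of m] by (simp add: r_def)
          ultimately show "\<omega> = r m \<and> y = x m" by auto
        next
          show "\<omega> = r m \<and> y = x m \<Longrightarrow> fun_upd \<omega> m y = r (Suc m)"
            by (auto simp: r_def fun_eq_iff)
        qed
        then show ?thesis by auto
      qed
      then show "emeasure (eP m \<omega>) {r (Suc m)} =
          emeasure (erw_kernel \<beta> m x) {x m} * indicator {r m} \<omega>"
        using emeasure_eP[OF \<omega> sing[of "Suc m"]] ker[of m] by (simp split: split_indicator)
    qed
    also have "\<dots> = emeasure (erw_kernel \<beta> m x) {x m} * emeasure (C 0 m (\<lambda>_. undefined)) {r m}"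
      using sing[of m] by (simp add: nn_integral_cmult_indicator sets_C space_PiM)
    finally show ?thesis .
  qed
  have ker_Suc: "emeasure (erw_kernel \<beta> (Suc m) x) {x (Suc m)} =
      ennreal (erw_step_prob \<beta> m x (x (Suc m)))" for m
    by (simp add: erw_kernel_def emeasure_density nn_integral_indicator_singleton')
  have C0: "emeasure (C 0 0 (\<lambda>_. undefined)) {r 0} = 1"
    by (simp add: r_def PiM_empty restrict_def)
  have C: "emeasure (C 0 (Suc n) (\<lambda>_. undefined)) {r (Suc n)} =
      (if x 0 = 0 then (\<Prod>i<n. ennreal (erw_step_prob \<beta> i x (x (Suc i)))) else 0)"
  proof (induction n)
    case 0
    show ?case unfolding C_step C0 by (simp add: erw_kernel_def indicator_def)
  next
    case (Suc n)
    show ?case unfolding C_step[of "Suc n"] Suc ker_Suc by (simp add: mult.commute)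
  qed
  have "{\<omega>. \<forall>i\<le>n. \<omega> i = x i} = PF.emb UNIV {0..<Suc n} {r (Suc n)}"
    by (auto simp: prod_emb_def r_def restrict_def fun_eq_iff less_Suc_eq_le split: if_splits)
  then have "emeasure (erw_law \<beta>) {\<omega>. \<forall>i\<le>n. \<omega> i = x i} = emeasure (CI {0..<Suc n}) {r (Suc n)}"
    unfolding erw_law_def using lim[OF _ sing[of "Suc n"]] by simp
  also have "\<dots> = emeasure (C 0 (Suc n) (\<lambda>_. undefined)) {r (Suc n)}"
    using emeasure_CI[OF subset_refl sing[of "Suc n"]] sets.sets_into_space[OF sing[of "Suc n"]]
    by (simp add: prod_emb_id space_PiM del: C.simps)
  finally show ?thesis using C by simp
qed

definition converges_in_prob ::
    "'a measure \<Rightarrow> (nat \<Rightarrow> 'a \<Rightarrow> 'b::metric_space) \<Rightarrow> 'b \<Rightarrow> bool" where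
  "converges_in_prob M X l \<longleftrightarrow>
     (\<forall>\<epsilon>>0. (\<lambda>n. measure M {\<omega> \<in> space M. dist (X n \<omega>) l > \<epsilon>}) \<longlonglongrightarrow> 0)"

end

theory Submission
  imports Defs "HOL-Real_Asymp.Real_Asymp"
begin

text \<open>
  The excitation only acts along the first coordinate.  Deleting that coordinate turns the walk
  into a lazy simple random walk on \<open>\<int>\<^sup>D\<close> with \<open>D = d - 1 \<ge> 5\<close>, which does not see the excitation at
  all: the \<^emph>\<open>transverse walk\<close>.  In dimension at least five such a walk has many \<^emph>\<open>cut times\<close>, times
  at which the sites visited before and the sites visited from then on are disjoint.  At a cut time
  of the transverse walk the excited walk never again meets its own past, so from there
  on it evolves like an excited walk that has just been started.

  To exploit this the excited walk is written as a deterministic function of independent, identically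
  distributed noise variables, listed with the newest first.  If there is a cut time among the last
  \<open>m\<close> steps, then the question whether the current site is visited for the first time has the same
  answer for the whole walk and for the walk driven by the last \<open>m\<close> noise variables alone.  The latter
  is independent of everything that happened more than \<open>m\<close> steps ago.  Hence the
  whole theorem rests on a bound for the probability that a window of length \<open>m\<close> has no
  cut time, and \<open>Pr_no_cut_decay\<close> shows that it is \<open>O(m\<^sup>-\<^sup>\<rho>)\<close> with \<open>\<rho> = min 1 ((d - 5) / 2)\<close>.

  That bound holds for every walk on an abelian group whose return probabilities are
  \<open>O(k\<^sup>-\<^sup>2\<^sup>-\<^sup>\<rho>)\<close>.  Decomposing two walks with a common starting point at their last intersection shows
  that a given time is a cut time with probability bounded below (\<open>cut_prob_lower_bound\<close>).  A long
  window contains several shorter ones, whose \<^emph>\<open>local\<close> cut times are independent; it can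
  only lack a cut time if all the shorter ones do, or if the walk meets itself after a long time, and
  the latter has probability \<open>O(m\<^sup>-\<^sup>\<rho>)\<close>.  Iterating this comparison over the scales preserves the rate.
  The required return probability, \<open>O(k\<^sup>-\<^sup>D\<^sup>/\<^sup>2)\<close>, is computed by conditioning on the
  numbers of steps in the various directions (\<open>transverse_return_prob\<close>).

  Each first visit contributes the drift \<open>\<beta> / d\<close>, so the mean position is \<open>\<beta> / d\<close> times the
  sum of the probabilities of a first visit, and these converge at rate \<open>O(n\<^sup>-\<^sup>\<rho>)\<close> by decoupling.  Summing
  gives part (a).  Decoupling also makes the deviation from the limiting line almost uncorrelated with
  the current drift, which keeps its second moment at \<open>o(n\<^sup>2)\<close>; part (b) follows from Chebyshev's
  inequality.
\<close>

section \<open>Expectations over lists of independent samples\<close>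

lemma finite_set_replicate_pmf [simp]:
  "finite (set_pmf (replicate_pmf n (p :: 'a::finite pmf)))"
  by (auto simp: set_replicate_pmf intro: finite_subset[OF _ finite_lists_length_eq[of UNIV n]])

lemma integrable_replicate_pmf [simp]:
  fixes f :: "'a::finite list \<Rightarrow> 'b::{banach, second_countable_topology}"
  shows "integrable (measure_pmf (replicate_pmf n p)) f"
  by (rule integrable_measure_pmf_finite) simp

lemma expectation_bind_finite:
  fixes h :: "'b \<Rightarrow> 'c::{banach, second_countable_topology}"
  assumes "finite (set_pmf p)" "\<And>x. x \<in> set_pmf p \<Longrightarrow> finite (set_pmf (f x))"
  shows "measure_pmf.expectation (bind_pmf p f) h =
         measure_pmf.expectation p (\<lambda>x. measure_pmf.expectation (f x) h)"
  by (subst pmf_expectation_bind[of "set_pmf p"])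
     (use assms in \<open>auto simp: integral_measure_pmf[of "set_pmf p"] intro!: sum.cong\<close>)

lemma expectation_replicate_Suc:
  fixes f :: "'a::finite list \<Rightarrow> 'b::{banach, second_countable_topology}"
  shows "measure_pmf.expectation (replicate_pmf (Suc n) p) f =
         measure_pmf.expectation p (\<lambda>x. measure_pmf.expectation (replicate_pmf n p) (\<lambda>xs. f (x # xs)))"
  by (simp add: expectation_bind_finite set_bind_pmf)

declare replicate_pmf.simps(2) [simp del]

lemma expectation_replicate_append:
  fixes f :: "'a::finite list \<Rightarrow> 'b::{banach, second_countable_topology}"
  shows "measure_pmf.expectation (replicate_pmf (m + n) p) f =
         measure_pmf.expectation (replicate_pmf m p) (\<lambda>xs.
           measure_pmf.expectation (replicate_pmf n p) (\<lambda>ys. f (xs @ ys)))"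
  by (simp add: replicate_pmf_distrib expectation_bind_finite set_bind_pmf)

lemma expectation_replicate_cong:
  fixes f :: "'a::finite list \<Rightarrow> 'b::{banach, second_countable_topology}"
  assumes "\<And>xs. length xs = n \<Longrightarrow> f xs = g xs"
  shows "measure_pmf.expectation (replicate_pmf n p) f = measure_pmf.expectation (replicate_pmf n p) g"
  using assms by (intro integral_cong_AE) (auto simp: AE_measure_pmf_iff set_replicate_pmf)

lemma expectation_replicate_mono:
  fixes f :: "'a::finite list \<Rightarrow> real"
  assumes "\<And>xs. length xs = n \<Longrightarrow> f xs \<le> g xs"
  shows "measure_pmf.expectation (replicate_pmf n p) f \<le> measure_pmf.expectation (replicate_pmf n p) g"
  using assms by (intro integral_mono_AE) (auto simp: AE_measure_pmf_iff set_replicate_pmf)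

lemma expectation_replicate_take_drop:
  fixes f :: "'a::finite list \<Rightarrow> 'a list \<Rightarrow> 'b::{banach, second_countable_topology}"
  assumes "m \<le> n"
  shows "measure_pmf.expectation (replicate_pmf n p) (\<lambda>zs. f (take m zs) (drop m zs)) =
         measure_pmf.expectation (replicate_pmf m p) (\<lambda>xs.
           measure_pmf.expectation (replicate_pmf (n - m) p) (\<lambda>ys. f xs ys))"
proof -
  have "measure_pmf.expectation (replicate_pmf (m + (n - m)) p) (\<lambda>zs. f (take m zs) (drop m zs)) =
         measure_pmf.expectation (replicate_pmf m p) (\<lambda>xs.
           measure_pmf.expectation (replicate_pmf (n - m) p) (\<lambda>ys. f xs ys))"
    unfolding expectation_replicate_append
    by (intro expectation_replicate_cong) simp
  then show ?thesis using assms by simp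
qed

lemma expectation_replicate_take_drop3:
  fixes f :: "'a::finite list \<Rightarrow> 'a list \<Rightarrow> 'a list \<Rightarrow> 'b::{banach, second_countable_topology}"
  assumes "i \<le> j" "j \<le> n"
  shows "measure_pmf.expectation (replicate_pmf n p)
           (\<lambda>zs. f (take i zs) (take (j - i) (drop i zs)) (drop j zs)) =
         measure_pmf.expectation (replicate_pmf i p) (\<lambda>xs.
           measure_pmf.expectation (replicate_pmf (j - i) p) (\<lambda>ys.
             measure_pmf.expectation (replicate_pmf (n - j) p) (\<lambda>ws. f xs ys ws)))"
proof -
  have "measure_pmf.expectation (replicate_pmf n p)
           (\<lambda>zs. f (take i zs) (take (j - i) (drop i zs)) (drop (j - i) (drop i zs))) =
         measure_pmf.expectation (replicate_pmf i p) (\<lambda>xs.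
           measure_pmf.expectation (replicate_pmf (j - i) p) (\<lambda>ys.
             measure_pmf.expectation (replicate_pmf (n - i - (j - i)) p) (\<lambda>ws. f xs ys ws)))"
    using assms
    by (subst expectation_replicate_take_drop[where
          f = "\<lambda>xs ys. f xs (take (j - i) ys) (drop (j - i) ys)"], simp,
        subst expectation_replicate_take_drop) auto
  then show ?thesis using assms by simp
qed

lemma prob_eq_expectation:
  "measure_pmf.prob M {x. Q x} = measure_pmf.expectation M (\<lambda>x. of_bool (Q x) :: real)"
proof -
  have "(\<lambda>x. of_bool (Q x) :: real) = indicator {x. Q x}"
    by (auto simp: fun_eq_iff indicator_def)
  then show ?thesis by simp
qed

lemma expectation_replicate_Suc_swap:
  fixes f :: "'a::finite list \<Rightarrow> 'b::{banach, second_countable_topology}"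
  shows "measure_pmf.expectation (replicate_pmf (Suc n) p) f =
         measure_pmf.expectation (replicate_pmf n p) (\<lambda>xs. measure_pmf.expectation p (\<lambda>x. f (x # xs)))"
proof -
  have "measure_pmf.expectation p g = (\<Sum>x\<in>UNIV. pmf p x *\<^sub>R g x)" for g :: "'a \<Rightarrow> 'b"
    by (rule integral_measure_pmf) auto
  then show ?thesis
    by (simp add: expectation_replicate_Suc Bochner_Integration.integral_sum)
qed

section \<open>Cut times of a transient walk\<close>

text \<open>
  Noise variables \<open>z\<close> are drawn independently from \<open>p\<close>, and \<open>\<sigma> z\<close> is the step that \<open>z\<close> causes.  The
  walk is observed only through the partial sums of its steps; the noise may carry more information
  than the step, as it does for the excited walk.
\<close>

locale list_walk =
  fixes p :: "'a::finite pmf" and \<sigma> :: "'a \<Rightarrow> 'g::ab_group_add"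
begin

abbreviation expct :: "nat \<Rightarrow> ('a list \<Rightarrow> real) \<Rightarrow> real" where
  "expct n f \<equiv> measure_pmf.expectation (replicate_pmf n p) f"

abbreviation Pr :: "nat \<Rightarrow> ('a list \<Rightarrow> bool) \<Rightarrow> real" where
  "Pr n Q \<equiv> measure_pmf.prob (replicate_pmf n p) {zs. Q zs}"

lemma Pr_mono:
  assumes "\<And>zs. length zs = n \<Longrightarrow> Q zs \<Longrightarrow> R zs"
  shows "Pr n Q \<le> Pr n R"
  unfolding prob_eq_expectation using assms by (intro expectation_replicate_mono) auto

lemma Pr_cong:
  assumes "\<And>zs. length zs = n \<Longrightarrow> Q zs \<longleftrightarrow> R zs"
  shows "Pr n Q = Pr n R"
  using assms by (intro antisym Pr_mono) auto

lemma Pr_le_1: "Pr n Q \<le> 1"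
  by simp

lemma Pr_disj: "Pr n (\<lambda>zs. Q zs \<or> R zs) \<le> Pr n Q + Pr n R"
proof -
  have "{zs. Q zs \<or> R zs} = {zs. Q zs} \<union> {zs. R zs}" by auto
  then show ?thesis by (simp add: measure_subadditive)
qed

lemma Pr_Bex:
  assumes "finite I"
  shows "Pr n (\<lambda>zs. \<exists>i\<in>I. Q i zs) \<le> (\<Sum>i\<in>I. Pr n (Q i))"
proof -
  have "{zs. \<exists>i\<in>I. Q i zs} = (\<Union>i\<in>I. {zs. Q i zs})" by auto
  then show ?thesis
    by (simp, intro measure_pmf.finite_measure_subadditive_finite) (auto simp: assms)
qed

lemma Pr_not: "Pr n (\<lambda>zs. \<not> Q zs) = 1 - Pr n Q"
  using measure_pmf.prob_compl[of "{zs. Q zs}" "replicate_pmf n p"]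
  by (simp add: Compl_eq_Diff_UNIV[symmetric] Collect_neg_eq)

lemma Pr_window:
  assumes "s + m \<le> n"
  shows "Pr n (\<lambda>zs. Q (take m (drop s zs))) = Pr m Q"
  unfolding prob_eq_expectation
  using expectation_replicate_take_drop3[where i = s and j = "s + m" and n = n and p = p and
      f = "\<lambda>xs ys ws. of_bool (Q ys) :: real"] assms by simp

lemma Pr_windows:
  assumes "s + K * m \<le> n"
  shows "Pr n (\<lambda>zs. \<forall>i<K. Q (take m (drop (s + i * m) zs))) = Pr m Q ^ K"
  using assms
proof (induction K arbitrary: s n)
  case 0
  then show ?case by simp
next
  case (Suc K)
  have le: "s + m \<le> n" "(s + m) + K * m \<le> n" using Suc.prems by auto
  have idx: "take m (drop (s + i * m) zs) = take m (drop (i * m) (drop s zs))" for i zs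
    by (simp add: add.commute)
  have "Pr n (\<lambda>zs. \<forall>i<Suc K. Q (take m (drop (s + i * m) zs))) =
      expct n (\<lambda>zs. of_bool (Q (take m (drop s zs))) *
        of_bool (\<forall>i<K. Q (take m (drop (i * m) (drop (s + m) zs)))))"
    unfolding prob_eq_expectation
    by (intro expectation_replicate_cong)
       (auto simp: All_less_Suc2 algebra_simps)
  also have "\<dots> = Pr m Q * Pr (n - (s + m)) (\<lambda>ws. \<forall>i<K. Q (take m (drop (0 + i * m) ws)))"
    using expectation_replicate_take_drop3[where i = s and j = "s + m" and n = n and p = p and
      f = "\<lambda>xs ys ws. of_bool (Q ys) * of_bool (\<forall>i<K. Q (take m (drop (i * m) ws))) :: real"] le
    by (simp add: prob_eq_expectation)
  also have "Pr (n - (s + m)) (\<lambda>ws. \<forall>i<K. Q (take m (drop (0 + i * m) ws))) = Pr m Q ^ K"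
    using le by (intro Suc.IH) auto
  finally show ?case by simp
qed

definition prefix_sum :: "'a list \<Rightarrow> nat \<Rightarrow> 'g" where
  "prefix_sum zs i = sum_list (map \<sigma> (take i zs))"

text \<open>
  The order of the list does not matter for this notion: read backwards in time, index \<open>t\<close> still
  separates the partial sums up to \<open>t\<close> from those beyond \<open>t\<close>.  The site at index \<open>t\<close> itself counts with
  the entries before it.  If lists have the newest entry first, it is the first site after the cut.
\<close>

definition cut_at :: "'a list \<Rightarrow> nat \<Rightarrow> bool" where
  "cut_at zs t \<longleftrightarrow> (\<forall>i\<le>t. \<forall>j. t < j \<and> j \<le> length zs \<longrightarrow> prefix_sum zs i \<noteq> prefix_sum zs j)"

definition return_prob :: "nat \<Rightarrow> real" where
  "return_prob k = Pr k (\<lambda>zs. sum_list (map \<sigma> zs) = 0)"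

text \<open>
  For a walk with times on both sides of \<open>0\<close>: the probability that the next \<open>b\<close> sites all differ from the
  present site and from the \<open>a\<close> sites before it.
\<close>

definition cut_prob :: "nat \<Rightarrow> nat \<Rightarrow> real" where
  "cut_prob a b = Pr (a + b) (\<lambda>zs. cut_at zs a)"

lemma return_prob_nonneg: "0 \<le> return_prob k"
  by (simp add: return_prob_def)

lemma prefix_sum_window:
  "i \<le> m \<Longrightarrow> prefix_sum (take m (drop s zs)) i = prefix_sum zs (s + i) - prefix_sum zs s"
  by (simp add: prefix_sum_def take_add min_absorb1)

lemma sum_list_window:
  "i \<le> j \<Longrightarrow> sum_list (map \<sigma> (take (j - i) (drop i zs))) = prefix_sum zs j - prefix_sum zs i"
  using take_add[of i "j - i" zs] by (simp add: prefix_sum_def)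

lemma cut_window:
  assumes "cut_at zs (s + t)" "t < m" "s + m \<le> length zs"
  shows "cut_at (take m (drop s zs)) t"
  using assms by (auto simp: cut_at_def prefix_sum_window)

lemma Pr_prefix_sum_eq:
  assumes "i \<le> j" "j \<le> n"
  shows "Pr n (\<lambda>zs. prefix_sum zs i = prefix_sum zs j) = return_prob (j - i)"
proof -
  have "prefix_sum zs i = prefix_sum zs j \<longleftrightarrow> sum_list (map \<sigma> (take (j - i) (drop i zs))) = 0" for zs
    using assms by (auto simp: sum_list_window)
  then show ?thesis
    unfolding return_prob_def using Pr_window[of i "j - i" n "\<lambda>ys. sum_list (map \<sigma> ys) = 0"] assms
    by simp
qed

lemma cut_prob_antimono:
  assumes "a' \<le> a" "b' \<le> b"
  shows "cut_prob a b \<le> cut_prob a' b'"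
proof (cases "b' = 0")
  case True
  have "cut_prob a' b' = 1"
    unfolding cut_prob_def True
    by (subst Pr_cong[where R = "\<lambda>_. True"]) (auto simp: cut_at_def)
  then show ?thesis by (simp add: cut_prob_def)
next
  case False
  have "cut_prob a b \<le> Pr (a + b) (\<lambda>zs. cut_at (take (a' + b') (drop (a - a') zs)) a')"
    unfolding cut_prob_def using assms False
    by (intro Pr_mono cut_window) auto
  also have "\<dots> = cut_prob a' b'"
    unfolding cut_prob_def by (rule Pr_window) (use assms in auto)
  finally show ?thesis .
qed

lemma Pr_not_cut:
  assumes "t \<le> n"
  shows "Pr n (\<lambda>zs. \<not> cut_at zs t) = 1 - cut_prob t (n - t)"
  using assms by (simp add: Pr_not cut_prob_def)

text \<open>
  At most \<open>k + 1\<close> pairs at distance \<open>k\<close> straddle \<open>t\<close>.  The condition that return probabilities are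
  summable against this weight is what a simple random walk satisfies from dimension five on.
\<close>

lemma pair_sum_le:
  assumes "finite P" "\<And>i j. (i, j) \<in> P \<Longrightarrow> i \<le> t \<and> t \<le> j \<and> j \<le> n \<and> M \<le> j - i"
  shows "(\<Sum>(i, j)\<in>P. return_prob (j - i)) \<le> (\<Sum>k=M..n. (real k + 1) * return_prob k)"
proof -
  have inj: "inj_on (\<lambda>(i, j). (j - i, t - i)) P"
  proof (rule inj_onI, clarify)
    fix i j i' j' assume "(i, j) \<in> P" "(i', j') \<in> P" "j - i = j' - i'" "t - i = t - i'"
    then show "i = i' \<and> j = j'" using assms(2)[of i j] assms(2)[of i' j'] by arith
  qed
  have "(\<Sum>(i, j)\<in>P. return_prob (j - i)) =
      (\<Sum>(k, l)\<in>(\<lambda>(i, j). (j - i, t - i)) ` P. return_prob k)"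
    by (subst sum.reindex[OF inj]) (simp add: case_prod_unfold)
  also have "\<dots> \<le> (\<Sum>(k, l)\<in>(SIGMA k:{M..n}. {..k}). return_prob k)"
    by (rule sum_mono2) (use assms(2) in \<open>force simp: return_prob_nonneg\<close>)+
  also have "\<dots> = (\<Sum>k=M..n. (real k + 1) * return_prob k)"
    by (subst sum.Sigma[symmetric]) (auto simp: algebra_simps)
  finally show ?thesis .
qed

text \<open>
  The cost of a meeting between the two sides of a gap of length \<open>l\<close>.
\<close>

lemma Pr_long_range:
  assumes "a + l \<le> b"
  shows "Pr n (\<lambda>zs. \<exists>i\<le>a. \<exists>j. b \<le> j \<and> j \<le> n \<and> prefix_sum zs i = prefix_sum zs j)
     \<le> (\<Sum>k=l..n. (real k + 1) * return_prob k)"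
proof -
  define P where "P = {..a} \<times> {b..n}"
  have "Pr n (\<lambda>zs. \<exists>i\<le>a. \<exists>j. b \<le> j \<and> j \<le> n \<and> prefix_sum zs i = prefix_sum zs j)
     \<le> Pr n (\<lambda>zs. \<exists>x\<in>P. prefix_sum zs (fst x) = prefix_sum zs (snd x))"
    by (rule Pr_mono) (fastforce simp: P_def)
  also have "\<dots> \<le> (\<Sum>x\<in>P. Pr n (\<lambda>zs. prefix_sum zs (fst x) = prefix_sum zs (snd x)))"
    by (rule Pr_Bex) (simp add: P_def)
  also have "\<dots> = (\<Sum>(i, j)\<in>P. return_prob (j - i))"
    using assms by (auto simp: P_def Pr_prefix_sum_eq intro!: sum.cong)
  also have "\<dots> \<le> (\<Sum>k=l..n. (real k + 1) * return_prob k)"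
    by (rule pair_sum_le[of _ a]) (use assms in \<open>auto simp: P_def\<close>)
  finally show ?thesis .
qed

text \<open>
  Among the coincidences between a site up to time \<open>t\<close> and a site from \<open>t\<close> on, take the one that
  is extremal on both sides: \<open>i\<close> least, and then \<open>j\<close> greatest.  One exists because \<open>i = j = t\<close>
  is allowed.  Removing the closed loop between \<open>i\<close> and \<open>j\<close> leaves a walk that has a cut at \<open>i\<close>, since any
  meeting of its two halves would be a more extreme coincidence of the original walk.
\<close>

lemma last_intersection:
  assumes "t \<le> length zs"
  shows "\<exists>i\<le>t. \<exists>j. t \<le> j \<and> j \<le> length zs \<and> prefix_sum zs i = prefix_sum zs j \<and>
           cut_at (take i zs @ drop j zs) i"
proof -
  let ?n = "length zs"
  define meet where "meet i j \<longleftrightarrow> t \<le> j \<and> j \<le> ?n \<and> prefix_sum zs i = prefix_sum zs j" for i j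
  have ex: "\<exists>j. meet t j" using assms by (auto simp: meet_def)
  define i where "i = (LEAST i. \<exists>j. meet i j)"
  have i: "\<exists>j. meet i j" unfolding i_def by (rule LeastI_ex) (use ex in blast)
  have i_le: "i \<le> t" unfolding i_def by (rule Least_le) (rule ex)
  have i_min: "\<not> meet i' j" if "i' < i" for i' j
    using that not_less_Least i_def by blast
  define j where "j = (GREATEST j. meet i j)"
  have j: "meet i j" unfolding j_def
    by (rule GreatestI_ex_nat[OF i, of ?n]) (auto simp: meet_def)
  have j_max: "j' \<le> j" if "meet i j'" for j'
    unfolding j_def by (rule Greatest_le_nat[of "meet i" _ ?n, OF that]) (auto simp: meet_def)
  have "cut_at (take i zs @ drop j zs) i"
    unfolding cut_at_def
  proof safe
    fix i' l assume il: "i' \<le> i" "i < l" "l \<le> length (take i zs @ drop j zs)"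
      and eq: "prefix_sum (take i zs @ drop j zs) i' = prefix_sum (take i zs @ drop j zs) l"
    define j' where "j' = j + (l - i)"
    have len: "i \<le> ?n" "j \<le> ?n" "t \<le> j" using i_le assms j by (auto simp: meet_def)
    have j': "j < j'" "j' \<le> ?n" using il len by (auto simp: j'_def)
    have "prefix_sum (take i zs @ drop j zs) i' = prefix_sum zs i'"
      using il len by (simp add: prefix_sum_def min_absorb1 min_absorb2)
    moreover have "prefix_sum (take i zs @ drop j zs) l =
        prefix_sum zs i + (prefix_sum zs j' - prefix_sum zs j)"
      using il len j' sum_list_window[of j j' zs]
      by (simp add: prefix_sum_def min_absorb2 j'_def)
    ultimately have "prefix_sum zs i' = prefix_sum zs j'"
      using eq j by (simp add: meet_def)
    then have m: "meet i' j'" using len j' by (simp add: meet_def)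
    then show False using i_min[of i' j'] j_max[of j'] j' il by (cases "i' = i") auto
  qed
  then show ?thesis using i_le j by (auto simp: meet_def)
qed

text \<open>
  The loop and the walk that remains after its removal use disjoint sets of noise variables, so
  their probabilities multiply.
\<close>

lemma last_intersection_sum:
  assumes "t \<le> n"
  shows "1 \<le> (\<Sum>(i, j)\<in>{..t} \<times> {t..n}. return_prob (j - i) * cut_prob i (n - j))"
proof -
  define P where "P = {..t} \<times> {t..n}"
  define ev where "ev x zs \<longleftrightarrow> sum_list (map \<sigma> (take (snd x - fst x) (drop (fst x) zs))) = 0 \<and>
    cut_at (take (fst x) zs @ drop (snd x) zs) (fst x)" for x zs
  have "1 = Pr n (\<lambda>_. True)" by simp
  also have "\<dots> \<le> Pr n (\<lambda>zs. \<exists>x\<in>P. ev x zs)"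
  proof (rule Pr_mono)
    fix zs :: "'a list" assume "length zs = n"
    then obtain i j where "i \<le> t" "t \<le> j" "j \<le> n" "prefix_sum zs i = prefix_sum zs j"
      "cut_at (take i zs @ drop j zs) i"
      using last_intersection[of t zs] assms by auto
    then have "(i, j) \<in> P" "ev (i, j) zs" by (auto simp: P_def ev_def sum_list_window)
    then show "\<exists>x\<in>P. ev x zs" by blast
  qed
  also have "\<dots> \<le> (\<Sum>x\<in>P. Pr n (ev x))"
    by (rule Pr_Bex) (simp add: P_def)
  also have "\<dots> = (\<Sum>(i, j)\<in>P. return_prob (j - i) * cut_prob i (n - j))"
  proof (rule sum.cong[OF refl], clarify)
    fix i j assume "(i, j) \<in> P"
    then have ij: "i \<le> j" "j \<le> n" by (auto simp: P_def)
    have "Pr n (ev (i, j)) = expct n (\<lambda>zs. of_bool (sum_list (map \<sigma> (take (j - i) (drop i zs))) = 0) *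
        of_bool (cut_at (take i zs @ drop j zs) i))"
      by (simp add: prob_eq_expectation ev_def of_bool_conj)
    also have "\<dots> = return_prob (j - i) * expct i (\<lambda>xs. expct (n - j) (\<lambda>ws. of_bool (cut_at (xs @ ws) i)))"
      using expectation_replicate_take_drop3[OF ij, where p = p and
        f = "\<lambda>xs ys ws. of_bool (sum_list (map \<sigma> ys) = 0) * of_bool (cut_at (xs @ ws) i) :: real"]
      by (simp add: return_prob_def prob_eq_expectation)
    also have "expct i (\<lambda>xs. expct (n - j) (\<lambda>ws. of_bool (cut_at (xs @ ws) i))) = cut_prob i (n - j)"
      by (simp add: cut_prob_def prob_eq_expectation expectation_replicate_append)
    finally show "Pr n (ev (i, j)) = return_prob (j - i) * cut_prob i (n - j)" .
  qed
  finally show ?thesis unfolding P_def .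
qed


text \<open>
  In the decomposition at the last intersection the terms with a long loop contribute at most one half.
  In all other terms both remaining pieces are long, so that their cut probability is at most that
  of a pair of walks of length \<open>L\<close>, and the loops contribute a total of at most \<open>G\<close>.
\<close>

lemma cut_prob_lower_bound:
  assumes G: "\<And>N. (\<Sum>k\<le>N. (real k + 1) * return_prob k) \<le> G"
    and tail: "\<And>N. (\<Sum>k=M..N. (real k + 1) * return_prob k) \<le> 1/2"
  shows "G > 0" "cut_prob a b \<ge> 1 / (2 * G)"
proof -
  have r0: "return_prob 0 = 1" by (simp add: return_prob_def)
  show Gpos: "G > 0" using G[of 0] r0 by simp
  define L where "L = max M (max a b)"
  let ?P = "{..2 * L} \<times> {2 * L..4 * L}"
  \<comment> \<open>The loops that stay within distance L of the centre; both remaining pieces have length at least L.\<close>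
  define P1 where "P1 = {(i, j) \<in> ?P. L \<le> i \<and> j \<le> 3 * L}"
  define P2 where "P2 = ?P - P1"
  have fin: "finite P1" "finite P2"
    by (auto simp: P1_def P2_def intro: finite_subset[of _ ?P])
  have "1 \<le> (\<Sum>(i, j)\<in>?P. return_prob (j - i) * cut_prob i (4 * L - j))"
    by (rule last_intersection_sum) simp
  also have "\<dots> = (\<Sum>(i, j)\<in>P1. return_prob (j - i) * cut_prob i (4 * L - j)) +
      (\<Sum>(i, j)\<in>P2. return_prob (j - i) * cut_prob i (4 * L - j))"
    unfolding P2_def by (subst sum.subset_diff[of P1 ?P]) (auto simp: P1_def)
  also have "(\<Sum>(i, j)\<in>P1. return_prob (j - i) * cut_prob i (4 * L - j)) \<le>
      (\<Sum>(i, j)\<in>P1. return_prob (j - i) * cut_prob L L)"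
    by (rule sum_mono)
       (auto simp: P1_def return_prob_nonneg intro!: mult_left_mono cut_prob_antimono)
  also have "\<dots> = (\<Sum>(i, j)\<in>P1. return_prob (j - i)) * cut_prob L L"
    by (simp add: sum_distrib_right case_prod_unfold)
  also have "\<dots> \<le> G * cut_prob L L"
  proof (rule mult_right_mono)
    have "(\<Sum>(i, j)\<in>P1. return_prob (j - i)) \<le> (\<Sum>k=0..4*L. (real k + 1) * return_prob k)"
      by (rule pair_sum_le[of _ "2 * L"]) (use fin in \<open>auto simp: P1_def\<close>)
    then show "(\<Sum>(i, j)\<in>P1. return_prob (j - i)) \<le> G"
      using G[of "4 * L"] by (simp add: atMost_atLeast0)
  qed (simp add: cut_prob_def)
  also have "(\<Sum>(i, j)\<in>P2. return_prob (j - i) * cut_prob i (4 * L - j)) \<le>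
      (\<Sum>(i, j)\<in>P2. return_prob (j - i))"
    by (rule sum_mono)
       (auto simp: cut_prob_def return_prob_nonneg intro!: mult_left_le)
  also have "\<dots> \<le> (\<Sum>k=M..4*L. (real k + 1) * return_prob k)"
    by (rule pair_sum_le[of _ "2 * L"]) (use fin in \<open>auto simp: P1_def P2_def L_def\<close>)
  also have "\<dots> \<le> 1/2" by (rule tail)
  finally have "1 / (2 * G) \<le> cut_prob L L" using Gpos by (simp add: field_simps)
  also have "\<dots> \<le> cut_prob a b" by (rule cut_prob_antimono) (auto simp: L_def)
  finally show "cut_prob a b \<ge> 1 / (2 * G)" .
qed

definition no_cut :: "'a list \<Rightarrow> nat \<Rightarrow> nat \<Rightarrow> bool" where
  "no_cut zs a l \<longleftrightarrow> (\<forall>t. a \<le> t \<and> t < a + l \<longrightarrow> \<not> cut_at zs t)"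

text \<open>
  The window is divided into \<open>K\<close> blocks of length \<open>3 * l\<close>.  Only the middle third of a block is searched
  for local cut times; the outer thirds are buffers.  If a local cut time fails to be a
  global one, then the walk returns to a place that it left at least \<open>l\<close> steps before, since one of
  the two meeting times lies outside the block and the other one is separated from it by a buffer.
\<close>

lemma no_cut_multiscale:
  assumes "no_cut zs a L" "3 * K * l \<le> L" "a + L \<le> length zs" "l > 0"
  shows "(\<forall>i<K. no_cut (take (3 * l) (drop (a + i * (3 * l)) zs)) l l) \<or>
    (\<exists>s\<in>(\<lambda>i. a + i * (3 * l)) ` {..<K} \<union> (\<lambda>i. a + i * (3 * l) + 2 * l) ` {..<K}.
       \<exists>i\<le>s. \<exists>j. s + l \<le> j \<and> j \<le> length zs \<and> prefix_sum zs i = prefix_sum zs j)"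
proof (rule disj_imp[THEN iffD2], rule impI)
  assume "\<not> (\<forall>i<K. no_cut (take (3 * l) (drop (a + i * (3 * l)) zs)) l l)"
  then obtain i t where i: "i < K" and t: "l \<le> t" "t < l + l"
    and cut: "cut_at (take (3 * l) (drop (a + i * (3 * l)) zs)) t"
    by (auto simp: no_cut_def)
  define s where "s = a + i * (3 * l)"
  have "(i + 1) * (3 * l) \<le> K * (3 * l)" using i by (intro mult_right_mono) auto
  then have s: "s + 3 * l \<le> a + L" using assms(2) by (simp add: s_def algebra_simps)
  have len: "length (take (3 * l) (drop s zs)) = 3 * l" using s assms(3) by simp
  have "\<not> cut_at zs (s + t)" using assms(1) s t by (auto simp: no_cut_def s_def)
  then obtain u v where uv: "u \<le> s + t" "s + t < v" "v \<le> length zs"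
    and eq: "prefix_sum zs u = prefix_sum zs v"
    unfolding cut_at_def by blast
  have "u < s \<or> s + 3 * l < v"
  proof (rule ccontr)
    assume "\<not> (u < s \<or> s + 3 * l < v)"
    then have "u - s \<le> t" "t < v - s" "v - s \<le> 3 * l" "s + (u - s) = u" "s + (v - s) = v"
      using uv by auto
    then have "prefix_sum (take (3 * l) (drop s zs)) (u - s) \<noteq>
               prefix_sum (take (3 * l) (drop s zs)) (v - s)"
      using cut len unfolding cut_at_def s_def[symmetric] by auto
    then show False
      using \<open>u - s \<le> t\<close> \<open>t < v - s\<close> \<open>v - s \<le> 3 * l\<close> \<open>s + (u - s) = u\<close> \<open>s + (v - s) = v\<close> eq
      by (simp add: prefix_sum_window)
  qed
  then have "(\<exists>i\<le>s. \<exists>j. s + l \<le> j \<and> j \<le> length zs \<and> prefix_sum zs i = prefix_sum zs j) \<or>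
    (\<exists>i\<le>s+2*l. \<exists>j. s + 2 * l + l \<le> j \<and> j \<le> length zs \<and> prefix_sum zs i = prefix_sum zs j)"
  proof
    assume "u < s"
    then show ?thesis using uv t eq by (intro disjI1 exI[of _ u] conjI exI[of _ v]) auto
  next
    assume "s + 3 * l < v"
    then show ?thesis using uv t eq by (intro disjI2 exI[of _ u] conjI exI[of _ v]) auto
  qed
  then show "\<exists>s\<in>(\<lambda>i. a + i * (3 * l)) ` {..<K} \<union> (\<lambda>i. a + i * (3 * l) + 2 * l) ` {..<K}.
       \<exists>i\<le>s. \<exists>j. s + l \<le> j \<and> j \<le> length zs \<and> prefix_sum zs i = prefix_sum zs j"
    using i unfolding s_def by blast
qed

text \<open>
  The blocks are disjoint, so their local events are independent, and each has the law of a window of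
  length \<open>l\<close> inside a walk of length \<open>3 * l\<close>.
\<close>

lemma Pr_no_cut_recursion:
  assumes x: "\<And>n a. a + l \<le> n \<Longrightarrow> Pr n (\<lambda>zs. no_cut zs a l) \<le> x"
    and y: "\<And>N. (\<Sum>k=l..N. (real k + 1) * return_prob k) \<le> y"
    and "3 * K * l \<le> L" "a + L \<le> n" "l > 0"
  shows "Pr n (\<lambda>zs. no_cut zs a L) \<le> x ^ K + 2 * real K * y"
proof -
  define I where "I = (\<lambda>i. a + i * (3 * l)) ` {..<K} \<union> (\<lambda>i. a + i * (3 * l) + 2 * l) ` {..<K}"
  define far where "far s zs \<longleftrightarrow> (\<exists>i\<le>s. \<exists>j. s + l \<le> j \<and> j \<le> n \<and> prefix_sum zs i = prefix_sum zs j)"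
    for s zs
  have finI: "finite I" by (simp add: I_def)
  have "card I \<le> card {..<K} + card {..<K}"
    unfolding I_def by (intro order.trans[OF card_Un_le] add_mono card_image_le) auto
  then have cardI: "card I \<le> 2 * K" by simp
  have y0: "0 \<le> y" using y[of 0] by (rule order.trans[rotated]) (auto intro!: sum_nonneg simp: return_prob_nonneg)
  have "Pr n (\<lambda>zs. no_cut zs a L) \<le> Pr n (\<lambda>zs.
      (\<forall>i<K. no_cut (take (3 * l) (drop (a + i * (3 * l)) zs)) l l) \<or> (\<exists>s\<in>I. far s zs))"
    unfolding I_def far_def using no_cut_multiscale[of _ a L K l] assms by (intro Pr_mono) blast
  also have "\<dots> \<le> Pr n (\<lambda>zs. \<forall>i<K. no_cut (take (3 * l) (drop (a + i * (3 * l)) zs)) l l) +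
      Pr n (\<lambda>zs. \<exists>s\<in>I. far s zs)"
    by (rule Pr_disj)
  also have "Pr n (\<lambda>zs. \<forall>i<K. no_cut (take (3 * l) (drop (a + i * (3 * l)) zs)) l l) =
      Pr (3 * l) (\<lambda>zs. no_cut zs l l) ^ K"
    using assms by (intro Pr_windows) (simp add: algebra_simps)
  also have "\<dots> \<le> x ^ K" by (intro power_mono x) auto
  also have "Pr n (\<lambda>zs. \<exists>s\<in>I. far s zs) \<le> (\<Sum>s\<in>I. Pr n (far s))"
    by (rule Pr_Bex[OF finI])
  also have "\<dots> \<le> (\<Sum>s\<in>I. y)"
    unfolding far_def by (intro sum_mono order.trans[OF Pr_long_range[where l = l] y]) simp
  also have "\<dots> \<le> 2 * real K * y"
    using cardI y0 by (simp add: mult_right_mono)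
  finally show ?thesis by simp
qed

text \<open>
  Induction over the scales.  A single candidate already gives a bound \<open>1 - c\<close> that is uniform in
  the scale.  Using it for all but one of the \<open>K\<close> factors, and the induction hypothesis for the last one,
  costs a factor \<open>(1 - c) ^ (K - 1)\<close>, whereas passing from scale \<open>l\<close> to scale \<open>3 * K * l\<close> costs at most
  a factor \<open>3 * K\<close>; for large \<open>K\<close> the exponential gain wins.
\<close>

lemma Pr_no_cut_decay_of_tail:
  assumes B: "\<And>M N. (\<Sum>k=M..N. (real k + 1) * return_prob k) \<le> B * real (M + 1) powr -\<rho>"
    and \<rho>: "0 < \<rho>" "\<rho> \<le> 1"
    and c: "\<And>a b. c \<le> cut_prob a b" "0 < c"
  shows "\<exists>A. \<forall>L n a. a + L \<le> n \<longrightarrow> Pr n (\<lambda>zs. no_cut zs a L) \<le> A * real (L + 1) powr -\<rho>"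
proof -
  have c1: "c \<le> 1" using c(1)[of 0 0] by (auto simp: cut_prob_def intro: order.trans)
  have B0: "0 \<le> B" using B[of 0 0] return_prob_nonneg[of 0] by simp
  have one_cut: "Pr n (\<lambda>zs. no_cut zs a l) \<le> 1 - c" if "a + l \<le> n" "l > 0" for n a l
  proof -
    have "Pr n (\<lambda>zs. no_cut zs a l) \<le> Pr n (\<lambda>zs. \<not> cut_at zs a)"
      using that by (intro Pr_mono) (auto simp: no_cut_def)
    also have "\<dots> \<le> 1 - c" using Pr_not_cut[of a n] c(1)[of a "n - a"] that by simp
    finally show ?thesis .
  qed
  have "(\<lambda>K. 3 * real (Suc K) * (1 - c) ^ K) \<longlonglongrightarrow> 0"
  proof -
    have small: "norm (1 - c) < 1" using c(2) c1 by (simp add: abs_if)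
    have "(\<lambda>K. real K * (1 - c) ^ K) \<longlonglongrightarrow> 0" "(\<lambda>K. (1 - c) ^ K) \<longlonglongrightarrow> 0"
      using small by (auto intro!: LIMSEQ_power_zero powser_times_n_limit_0)
    then have "(\<lambda>K. 3 * (real K * (1 - c) ^ K) + 3 * (1 - c) ^ K) \<longlonglongrightarrow> 3 * 0 + 3 * 0"
      by (intro tendsto_add tendsto_mult_left)
    then show ?thesis by (simp add: algebra_simps)
  qed
  then obtain k where k: "3 * real (Suc k) * (1 - c) ^ k < 1/2"
    by (metis (no_types, lifting) order_tendstoD(2) eventually_sequentially half_gt_zero_iff
        zero_less_one order_refl)
  define K where "K = Suc k"
  \<comment> \<open>The first summand covers the scales below 3 * K, the second one absorbs the long-range error.\<close>
  define A where "A = 3 * real K + 12 * real K ^ 2 * B"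
  have A0: "0 \<le> A" "3 * real K \<le> A" using B0 by (auto simp: A_def)
  have bound: "Pr n (\<lambda>zs. no_cut zs a L) \<le> A * real (L + 1) powr -\<rho>" if "a + L \<le> n" for L n a
    using that
  proof (induction L arbitrary: n a rule: less_induct)
    case (less L)
    have powr_le: "real m powr \<rho> \<le> real m" if "m > 0" for m :: nat
      using powr_mono[of \<rho> 1 "real m"] \<rho> that by simp
    show ?case
    proof (cases "L < 3 * K")
      case True
      then have "real (L + 1) powr \<rho> \<le> A"
        using powr_le[of "L + 1"] A0 by linarith
      then have "1 \<le> A * real (L + 1) powr -\<rho>" by (simp add: powr_minus field_simps)
      then show ?thesis using Pr_le_1 order.trans by blast
    next
      case False
      define l where "l = L div (3 * K)"
      have l: "0 < l" "3 * K * l \<le> L" "l < L"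
        using False by (auto simp: l_def K_def div_greater_zero_iff)
      have "L < 3 * K * (l + 1)" unfolding l_def
        using dividend_less_times_div[of "3 * K" L] by (simp add: K_def)
      then have L_le: "real (L + 1) \<le> real (3 * K) * real (l + 1)"
        unfolding of_nat_mult[symmetric] of_nat_le_iff by simp
      define z where "z = real (l + 1) powr -\<rho>"
      have z_le: "z \<le> 3 * real K * real (L + 1) powr -\<rho>"
      proof -
        have "real (L + 1) powr \<rho> \<le> (real (3 * K) * real (l + 1)) powr \<rho>"
          using L_le \<rho> by (intro powr_mono2) auto
        also have "\<dots> = real (3 * K) powr \<rho> * real (l + 1) powr \<rho>"
          by (simp only: powr_mult)
        also have "\<dots> \<le> real (3 * K) * real (l + 1) powr \<rho>"
          by (intro mult_right_mono powr_le) (auto simp: K_def)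
        finally show ?thesis by (simp add: z_def powr_minus field_simps)
      qed
      define x where "x = min (1 - c) (A * z)"
      have x0: "0 \<le> x" using A0 c1 by (auto simp: x_def z_def)
      have "Pr n (\<lambda>zs. no_cut zs a L) \<le> x ^ K + 2 * real K * (B * z)"
      proof (rule Pr_no_cut_recursion[of l])
        show "Pr n (\<lambda>zs. no_cut zs a l) \<le> x" if "a + l \<le> n" for n a
          unfolding x_def z_def using that l one_cut[of a l n] less.IH[of l a n] by auto
        show "(\<Sum>k = l..N. (real k + 1) * return_prob k) \<le> B * z" for N
          unfolding z_def by (rule B)
      qed (use l less.prems in auto)
      also have "x ^ K + 2 * real K * (B * z) \<le> (1 - c) ^ k * (A * z) + 2 * real K * (B * z)"
        unfolding K_def power_Suc2
        using x0 by (intro add_right_mono mult_mono power_mono) (auto simp: x_def c1)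
      also have "(1 - c) ^ k * (A * z) + 2 * real K * (B * z) = ((1 - c) ^ k * A + 2 * real K * B) * z"
        by (simp add: algebra_simps)
      also have "\<dots> \<le> ((1 - c) ^ k * A + 2 * real K * B) * (3 * real K * real (L + 1) powr -\<rho>)"
        using z_le A0 B0 c1 by (intro mult_left_mono add_nonneg_nonneg mult_nonneg_nonneg) auto
      also have "\<dots> = ((3 * real K * (1 - c) ^ k) * A + 6 * real K ^ 2 * B) * real (L + 1) powr -\<rho>"
        by (simp add: algebra_simps power2_eq_square)
      also have "\<dots> \<le> (1/2 * A + 6 * real K ^ 2 * B) * real (L + 1) powr -\<rho>"
        using k A0 by (intro mult_right_mono add_right_mono) (auto simp: K_def)
      also have "\<dots> \<le> A * real (L + 1) powr -\<rho>"
        by (intro mult_right_mono) (auto simp: A_def)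
      finally show ?thesis .
    qed
  qed
  then show ?thesis by blast
qed

end

text \<open>
  Comparison with the integral, in the form of a telescoping sum.
\<close>

lemma sum_powr_tail_le:
  fixes \<rho> :: real
  assumes "0 < \<rho>"
  shows "(\<Sum>k=M..N. real (k + 1) powr (-1-\<rho>)) \<le> (1 + 1 / \<rho>) * real (M + 1) powr -\<rho>"
proof -
  have decr: "real (k + 2) powr (-1-\<rho>) \<le> (real (k + 1) powr -\<rho> - real (k + 2) powr -\<rho>) / \<rho>" for k
  proof -
    have "\<exists>z. real (k + 1) < z \<and> z < real (k + 2) \<and>
        - (real (k + 2) powr -\<rho>) - - (real (k + 1) powr -\<rho>) = (real (k + 2) - real (k + 1)) * (\<rho> * z powr (-\<rho> - 1))"
      by (rule MVT2) (auto intro!: derivative_eq_intros)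
    then obtain z where z: "real (k + 1) < z" "z < real (k + 2)"
      "real (k + 1) powr -\<rho> - real (k + 2) powr -\<rho> = \<rho> * z powr (-\<rho> - 1)" by auto
    have "real (k + 2) powr (-\<rho> - 1) \<le> z powr (-\<rho> - 1)"
      using z assms by (intro powr_mono2') auto
    moreover have "-1 - \<rho> = -\<rho> - 1" by simp
    ultimately show ?thesis using z assms by (simp only:) (simp add: field_simps)
  qed
  have main: "(\<Sum>k=M..N. real (k + 1) powr (-1-\<rho>)) \<le>
      (1 + 1 / \<rho>) * real (M + 1) powr -\<rho> - real (N + 1) powr -\<rho> / \<rho>" if "M \<le> N"
    using that
  proof (induction N rule: dec_induct)
    case base
    have "real (M + 1) powr (-1-\<rho>) \<le> real (M + 1) powr -\<rho>" by (intro powr_mono) auto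
    then show ?case by (simp add: algebra_simps)
  next
    case (step n)
    have "(\<Sum>k=M..Suc n. real (k + 1) powr (-1-\<rho>)) =
        (\<Sum>k=M..n. real (k + 1) powr (-1-\<rho>)) + real (n + 2) powr (-1-\<rho>)"
      using step.hyps by simp
    then show ?case using step.IH decr[of n] by (simp add: diff_divide_distrib)
  qed
  have "0 \<le> real (N + 1) powr -\<rho> / \<rho>" using assms by simp
  then show ?thesis using assms main by (cases "M \<le> N") (linarith, simp)
qed

text \<open>
  Under this hypothesis the expected number of meetings across a gap of length \<open>l\<close> is \<open>O(l\<^sup>-\<^sup>\<rho>)\<close>, and
  the comparison of scales transfers this rate to the absence of a cut time in a window of length \<open>l\<close>.
\<close>

theorem (in list_walk) Pr_no_cut_decay:
  assumes ret: "\<And>k. return_prob k \<le> C * real (k + 1) powr (-2-\<rho>)"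
    and \<rho>: "0 < \<rho>" "\<rho> \<le> 1"
  obtains A where "\<And>L n a. a + L \<le> n \<Longrightarrow> Pr n (\<lambda>zs. no_cut zs a L) \<le> A * real (L + 1) powr -\<rho>"
proof -
  define B where "B = C * (1 + 1 / \<rho>)"
  have C0: "0 \<le> C" using ret[of 0] return_prob_nonneg[of 0] by simp
  have tail: "(\<Sum>k=M..N. (real k + 1) * return_prob k) \<le> B * real (M + 1) powr -\<rho>" for M N
  proof -
    have "(\<Sum>k=M..N. (real k + 1) * return_prob k) \<le> (\<Sum>k=M..N. C * real (k + 1) powr (-1-\<rho>))"
    proof (rule sum_mono)
      fix k
      have "(real k + 1) * return_prob k \<le> (real k + 1) * (C * real (k + 1) powr (-2-\<rho>))"
        by (intro mult_left_mono ret) auto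
      also have "\<dots> = C * (real (k + 1) powr 1 * real (k + 1) powr (-2-\<rho>))" by simp
      also have "\<dots> = C * real (k + 1) powr (-1-\<rho>)" by (simp only: powr_add[symmetric]) simp
      finally show "(real k + 1) * return_prob k \<le> C * real (k + 1) powr (-1-\<rho>)" .
    qed
    also have "\<dots> \<le> C * ((1 + 1 / \<rho>) * real (M + 1) powr -\<rho>)"
      unfolding sum_distrib_left[symmetric] by (intro mult_left_mono sum_powr_tail_le C0 \<rho>)
    finally show ?thesis by (simp add: B_def)
  qed
  have "(\<lambda>M. B * real (M + 1) powr -\<rho>) \<longlonglongrightarrow> 0"
    using \<rho> by real_asymp
  then obtain M where "B * real (M + 1) powr -\<rho> < 1/2"
    by (metis (no_types, lifting) order_tendstoD(2) eventually_sequentially half_gt_zero_iff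
        zero_less_one order_refl)
  then have M: "(\<Sum>k=M..N. (real k + 1) * return_prob k) \<le> 1/2" for N
    using tail[of M N] by linarith
  have G: "(\<Sum>k\<le>N. (real k + 1) * return_prob k) \<le> B" for N
    using tail[of 0 N] by (simp add: atMost_atLeast0)
  have "\<exists>A. \<forall>L n a. a + L \<le> n \<longrightarrow> Pr n (\<lambda>zs. no_cut zs a L) \<le> A * real (L + 1) powr -\<rho>"
    using cut_prob_lower_bound[OF G M] by (intro Pr_no_cut_decay_of_tail[OF tail \<rho>, of "1 / (2 * B)"]) auto
  then show ?thesis using that by blast
qed

section \<open>Return probabilities of the transverse walk\<close>

text \<open>
  The probability that the simple random walk on \<open>\<int>\<close> is at \<open>x\<close> after \<open>m\<close> steps, of which
  \<open>(m + x) div 2\<close> then go upwards.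
\<close>

definition srw_pmf :: "nat \<Rightarrow> int \<Rightarrow> real" where
  "srw_pmf m x = (if even (int m + x) \<and> 0 \<le> int m + x
     then real (m choose nat ((int m + x) div 2)) / 2 ^ m else 0)"

lemma srw_pmf_0: "srw_pmf 0 x = of_bool (x = 0)"
  by (auto simp: srw_pmf_def binomial_eq_0_iff elim!: evenE)

lemma srw_pmf_Suc: "srw_pmf (Suc m) x = (srw_pmf m (x - 1) + srw_pmf m (x + 1)) / 2"
proof (cases "even (int (Suc m) + x) \<and> 0 \<le> int (Suc m) + x")
  case True
  then obtain y where y: "int (Suc m) + x = 2 * y" by blast
  define j where "j = nat y"
  have j: "int (Suc m) + x = 2 * int j" using True y by (simp add: j_def)
  have x: "x = 2 * int j - int m - 1" using j by simp
  show ?thesis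
  proof (cases j)
    case 0
    then show ?thesis by (simp add: srw_pmf_def x)
  next
    case (Suc i)
    have "srw_pmf (Suc m) x = real (Suc m choose j) / 2 ^ Suc m"
      unfolding srw_pmf_def j by simp
    moreover have "int m + (x - 1) = 2 * int i" "int m + (x + 1) = 2 * int j"
      using x Suc by simp_all
    then have "srw_pmf m (x - 1) = real (m choose i) / 2 ^ m" "srw_pmf m (x + 1) = real (m choose j) / 2 ^ m"
      unfolding srw_pmf_def by simp_all
    ultimately show ?thesis using Suc by (simp add: add_divide_distrib)
  qed
next
  case False
  then have "\<not> (even (int m + (x - 1)) \<and> 0 \<le> int m + (x - 1))"
    "even (int m + (x + 1)) \<Longrightarrow> \<not> 0 \<le> int m + (x + 1)"
    by (simp_all, presburger+)
  then show ?thesis using False unfolding srw_pmf_def by auto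
qed

lemma srw_pmf_nonneg: "0 \<le> srw_pmf m x"
  by (simp add: srw_pmf_def)

text \<open>
  Passing from \<open>n\<close> to \<open>n + 1\<close> multiplies the left-hand side by \<open>(2 * n + 1) / (2 * n + 2)\<close>, which is at most
  \<open>sqrt ((2 * n + 1) / (2 * n + 3))\<close>.
\<close>

lemma central_binomial_upper: "real ((2 * n) choose n) / 4 ^ n \<le> 1 / sqrt (2 * real n + 1)"
proof (induction n)
  case (Suc n)
  have eq: "real ((2 * Suc n) choose Suc n) / 4 ^ Suc n =
      real ((2 * n) choose n) / 4 ^ n * ((2 * real n + 1) / (2 * real n + 2))"
  proof -
    have "real ((2 * Suc n) choose Suc n) = fact (2 * Suc n) / (fact (Suc n) * fact (Suc n))"
      using binomial_fact[of "Suc n" "2 * Suc n", where 'a = real] by simp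
    also have "\<dots> = ((2 * real n + 2) * (2 * real n + 1) * fact (2 * n)) /
        ((real n + 1) * fact n * ((real n + 1) * fact n))"
      by (simp add: algebra_simps)
    also have "\<dots> = fact (2 * n) / (fact n * fact n) * (2 * (2 * real n + 1) / (real n + 1))"
      by (simp add: divide_simps) (simp add: algebra_simps)
    also have "fact (2 * n) / (fact n * fact n) = real ((2 * n) choose n)"
      using binomial_fact[of n "2 * n", where 'a = real] by simp
    finally show ?thesis by (simp add: divide_simps) (simp add: algebra_simps)
  qed
  have "(2 * real n + 1) * (2 * real n + 3) \<le> (2 * real n + 2) ^ 2"
    by (simp add: power2_eq_square algebra_simps)
  then have "sqrt (2 * real n + 1) * sqrt (2 * real n + 3) \<le> 2 * real n + 2"
    unfolding real_sqrt_mult[symmetric] by (rule real_le_lsqrt[rotated 1]) auto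
  then have le: "sqrt (2 * real n + 1) / (2 * real n + 2) \<le> 1 / sqrt (2 * real n + 3)"
    by (simp add: pos_divide_le_eq pos_le_divide_eq add_pos_nonneg)
  have "1 / sqrt (2 * real n + 1) * ((2 * real n + 1) / (2 * real n + 2)) =
      ((2 * real n + 1) / sqrt (2 * real n + 1)) / (2 * real n + 2)"
    by simp
  also have "(2 * real n + 1) / sqrt (2 * real n + 1) = sqrt (2 * real n + 1)"
    by (rule real_div_sqrt) simp
  also note le
  finally have "1 / sqrt (2 * real n + 1) * ((2 * real n + 1) / (2 * real n + 2)) \<le> 1 / sqrt (2 * real n + 3)" .
  moreover have "real ((2 * n) choose n) / 4 ^ n * ((2 * real n + 1) / (2 * real n + 2)) \<le>
      1 / sqrt (2 * real n + 1) * ((2 * real n + 1) / (2 * real n + 2))"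
    by (intro mult_right_mono Suc.IH) auto
  ultimately show ?case unfolding eq by (simp add: add.commute)
qed simp

lemma srw_pmf_return_le: "srw_pmf m 0 \<le> 1 / sqrt (real m + 1)"
proof (cases "even m")
  case True
  then obtain n where m: "m = 2 * n" by blast
  show ?thesis using central_binomial_upper[of n] by (simp add: m srw_pmf_def power_mult)
qed (simp add: srw_pmf_def)

text \<open>
  A size-biasing identity: choosing one of the \<open>Suc n\<close> positions and requiring it to
  carry the letter \<open>k\<close> leaves \<open>n\<close> free letters.
\<close>

lemma expectation_count_mset:
  fixes h :: "'k::finite multiset \<Rightarrow> real" and k :: "'k"
  shows "measure_pmf.expectation (replicate_pmf (Suc n) (pmf_of_set UNIV)) (\<lambda>ks. real (count (mset ks) k) * h (mset ks)) =
    real (Suc n) / real CARD('k) *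
    measure_pmf.expectation (replicate_pmf n (pmf_of_set UNIV)) (\<lambda>ks. h (add_mset k (mset ks)))"
proof (induction n arbitrary: h)
  case 0
  show ?case
    by (subst expectation_replicate_Suc)
       (simp add: integral_pmf_of_set if_distrib[of real] if_distrib[of "\<lambda>x. x * _"] cong: if_cong)
next
  case (Suc n)
  let ?U = "pmf_of_set (UNIV :: 'k set)"
  let ?E = "\<lambda>n. measure_pmf.expectation (replicate_pmf n ?U) :: ('k list \<Rightarrow> real) \<Rightarrow> real"
  have U: "measure_pmf.expectation ?U f = (\<Sum>a\<in>UNIV. f a) / real CARD('k)" for f :: "'k \<Rightarrow> real"
    by (simp add: integral_pmf_of_set)
  have "?E (Suc (Suc n)) (\<lambda>ks. real (count (mset ks) k) * h (mset ks)) =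
      (\<Sum>a\<in>UNIV. ?E (Suc n) (\<lambda>ks. real (count (mset ks) k) * h (add_mset a (mset ks)) +
        of_bool (a = k) * h (add_mset a (mset ks)))) / real CARD('k)"
    by (subst expectation_replicate_Suc, subst U)
       (auto intro!: sum.cong Bochner_Integration.integral_cong simp: algebra_simps)
  also have "\<dots> = (\<Sum>a\<in>UNIV. ?E (Suc n) (\<lambda>ks. real (count (mset ks) k) * h (add_mset a (mset ks)))) / real CARD('k) +
      ?E (Suc n) (\<lambda>ks. h (add_mset k (mset ks))) / real CARD('k)"
  proof -
    have "?E (Suc n) (\<lambda>ks. real (count (mset ks) k) * h (add_mset a (mset ks)) + of_bool (a = k) * h (add_mset a (mset ks))) =
      ?E (Suc n) (\<lambda>ks. real (count (mset ks) k) * h (add_mset a (mset ks))) +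
      (if a = k then ?E (Suc n) (\<lambda>ks. h (add_mset k (mset ks))) else 0)" for a
      by (cases "a = k") auto
    then show ?thesis by (simp add: sum.distrib add_divide_distrib)
  qed
  also have "(\<Sum>a\<in>UNIV. ?E (Suc n) (\<lambda>ks. real (count (mset ks) k) * h (add_mset a (mset ks)))) / real CARD('k) =
      real (Suc n) / real CARD('k) * ((\<Sum>a\<in>UNIV. ?E n (\<lambda>ks. h (add_mset k (add_mset a (mset ks))))) / real CARD('k))"
    by (subst Suc.IH) (simp add: sum_distrib_left add_mset_commute)
  also have "(\<Sum>a\<in>UNIV. ?E n (\<lambda>ks. h (add_mset k (add_mset a (mset ks))))) / real CARD('k) =
      ?E (Suc n) (\<lambda>ks. h (add_mset k (mset ks)))"
    by (subst expectation_replicate_Suc, subst U) simp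
  finally show ?case by (simp add: field_simps)
qed

text \<open>
  Each factor is removed by the size-biasing identity, applied to a function with a
  factor \<open>1 / count M k\<close>.  That factor is zero if the letter is absent, because division by zero gives
  zero, and so the identity becomes an inequality in the right direction.
\<close>

lemma expectation_prod_inverse_counts:
  fixes K :: "'k::finite set"
  shows "measure_pmf.expectation (replicate_pmf n (pmf_of_set UNIV))
     (\<lambda>ks. \<Prod>k\<in>K. 1 / (real (count (mset ks) k) + 1)) \<le> (real CARD('k) / (real n + 1)) ^ card K"
    (is "?T n K \<le> _")
  using finite[of K]
proof (induction K arbitrary: n rule: finite_induct)
  case (insert k K)
  let ?E = "\<lambda>n. measure_pmf.expectation (replicate_pmf n (pmf_of_set (UNIV::'k set))) :: ('k list \<Rightarrow> real) \<Rightarrow> real"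
  define h :: "'k multiset \<Rightarrow> real" where
    "h M = (1 / real (count M k)) * (\<Prod>k\<in>K. 1 / (real (count M k) + 1))" for M
  have "real (Suc n) / real CARD('k) * ?T n (insert k K) =
      real (Suc n) / real CARD('k) * ?E n (\<lambda>ks. h (add_mset k (mset ks)))"
    using insert.hyps
    by (auto intro!: Bochner_Integration.integral_cong arg_cong2[where f = "(*)"] prod.cong simp: h_def add.commute)
  also have "\<dots> = ?E (Suc n) (\<lambda>ks. real (count (mset ks) k) * h (mset ks))"
    by (rule expectation_count_mset[symmetric])
  also have "\<dots> \<le> ?T (Suc n) K"
    by (intro expectation_replicate_mono) (auto simp: h_def intro!: prod_nonneg)
  also have "\<dots> \<le> (real CARD('k) / (real (Suc n) + 1)) ^ card K"
    by (rule insert.IH)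
  also have "\<dots> \<le> (real CARD('k) / (real n + 1)) ^ card K"
    by (intro power_mono divide_left_mono) auto
  finally have le: "real (Suc n) / real CARD('k) * ?T n (insert k K) \<le> (real CARD('k) / (real n + 1)) ^ card K" .
  have "?T n (insert k K) = real CARD('k) / (real n + 1) * (real (Suc n) / real CARD('k) * ?T n (insert k K))"
    by (simp add: add.commute)
  also have "\<dots> \<le> real CARD('k) / (real n + 1) * (real CARD('k) / (real n + 1)) ^ card K"
    by (intro mult_left_mono le) auto
  finally have "?T n (insert k K) \<le> real CARD('k) / (real n + 1) * (real CARD('k) / (real n + 1)) ^ card K" .
  then show ?case using insert.hyps by simp
qed simp


text \<open>
  One step of the walk uses a uniformly chosen axis, a fair sign, and a flag that is set with
  probability \<open>\<beta>\<close>.  At a first visit the flag turns a step along the first axis into a step in the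
  positive direction, which then has the probability \<open>(\<beta> + (1 - \<beta>) / 2) / d = (1 + \<beta>) / (2 * d)\<close>.
\<close>

type_synonym 'd noise = "'d \<times> bool \<times> bool"

definition noise_pmf :: "real \<Rightarrow> 'd::finite noise pmf" where
  "noise_pmf \<beta> = pair_pmf (pmf_of_set UNIV) (pair_pmf (bernoulli_pmf (1/2)) (bernoulli_pmf \<beta>))"

lemma expectation_noise_pmf:
  fixes f :: "'d::finite noise \<Rightarrow> 'b::{banach, second_countable_topology}"
  assumes "0 \<le> \<beta>" "\<beta> \<le> 1"
  shows "measure_pmf.expectation (noise_pmf \<beta>) f =
    (\<Sum>k\<in>UNIV. (\<beta> / 2) *\<^sub>R (f (k, True, True) + f (k, False, True)) +
      ((1 - \<beta>) / 2) *\<^sub>R (f (k, True, False) + f (k, False, False))) /\<^sub>R real CARD('d)"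
proof -
  have "measure_pmf.expectation (noise_pmf \<beta>) f = (\<Sum>z\<in>UNIV. pmf (noise_pmf \<beta>) z *\<^sub>R f z)"
    by (rule integral_measure_pmf) auto
  also have "\<dots> = (\<Sum>(k, s, b)\<in>UNIV \<times> UNIV \<times> UNIV. pmf (noise_pmf \<beta>) (k, s, b) *\<^sub>R f (k, s, b))"
    by (simp add: case_prod_unfold)
  also have "\<dots> = (\<Sum>k\<in>UNIV. \<Sum>s\<in>UNIV. \<Sum>b\<in>UNIV. pmf (noise_pmf \<beta>) (k, s, b) *\<^sub>R f (k, s, b))"
    by (simp only: sum.cartesian_product)
  also have "\<dots> = (\<Sum>k\<in>UNIV. (inverse (real CARD('d)) *\<^sub>R ((\<beta> / 2) *\<^sub>R (f (k, True, True) + f (k, False, True)) +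
      ((1 - \<beta>) / 2) *\<^sub>R (f (k, True, False) + f (k, False, False)))))"
    using assms
    by (intro sum.cong refl) (simp add: noise_pmf_def pmf_pair UNIV_bool scaleR_add_right field_simps)
  finally show ?thesis by (simp only: scaleR_sum_right)
qed

definition transverse_step :: "'d::{finite,one} noise \<Rightarrow> int ^ 'd::{finite,one}" where
  "transverse_step z = (case z of (k, s, b) \<Rightarrow> if k = 1 then 0 else axis k (if s then 1 else -1))"

text \<open>
  Given the chosen axes, the coordinates of the transverse walk are independent simple random walks
  on \<open>\<int>\<close>, run for as many steps as their axis was chosen.
\<close>

lemma prob_transverse_eq:
  fixes x :: "int ^ 'd::{finite,one}"
  assumes "0 \<le> \<beta>" "\<beta> \<le> 1" "x $ 1 = 0"
  shows "measure_pmf.prob (replicate_pmf n (noise_pmf \<beta>)) {zs. sum_list (map transverse_step zs) = x} =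
     measure_pmf.expectation (replicate_pmf n (pmf_of_set UNIV))
       (\<lambda>ks. \<Prod>k\<in>UNIV - {1}. srw_pmf (count (mset ks) k) (x $ k))"
  using assms(3)
proof (induction n arbitrary: x)
  case 0
  have "(0 = x) \<longleftrightarrow> (\<forall>k\<in>UNIV - {1}. x $ k = 0)" using 0 by (auto simp: vec_eq_iff)
  then have "of_bool (0 = x) = (\<Prod>k\<in>UNIV - {1}. of_bool (x $ k = 0) :: real)"
    by (auto simp: prod_zero_iff)
  then show ?case by (simp add: prob_eq_expectation srw_pmf_0)
next
  case (Suc n)
  define Q where "Q y = (\<lambda>ks. \<Prod>k\<in>UNIV - {1}. srw_pmf (count (mset ks) k) (y $ k))" for y :: "(int, 'd) vec"
  define P where "P y = measure_pmf.prob (replicate_pmf n (noise_pmf \<beta>)) {zs. sum_list (map transverse_step zs) = y}"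
    for y :: "(int, 'd) vec"
  let ?E = "\<lambda>n. measure_pmf.expectation (replicate_pmf n (pmf_of_set (UNIV::'d set))) :: ('d list \<Rightarrow> real) \<Rightarrow> real"
  have P: "P y = ?E n (Q y)" if "y $ 1 = 0" for y
    unfolding P_def Q_def by (rule Suc.IH[OF that])
  have step: "(P (x - transverse_step (k, True, b)) + P (x - transverse_step (k, False, b))) / 2 =
      ?E n (\<lambda>ks. Q x (k # ks))" for k b
  proof (cases "k = 1")
    case True
    have "Q x (1 # ks) = Q x ks" for ks by (auto simp: Q_def intro!: prod.cong)
    then show ?thesis using True P[of x] Suc.prems by (simp add: transverse_step_def)
  next
    case False
    have Q_Cons: "Q x (k # ks) = (Q (x - axis k 1) ks + Q (x - axis k (-1)) ks) / 2" for ks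
    proof -
      define R where "R = (\<Prod>j\<in>UNIV - {1} - {k}. srw_pmf (count (mset ks) j) (x $ j))"
      have k: "k \<in> UNIV - {1}" using False by simp
      have "Q (x - axis k c) ks = srw_pmf (count (mset ks) k) (x $ k - c) * R" for c
        unfolding Q_def R_def
        by (subst prod.remove[OF _ k]) (auto simp: axis_def intro!: prod.cong arg_cong2[where f = "(*)"])
      moreover have "Q x (k # ks) = srw_pmf (Suc (count (mset ks) k)) (x $ k) * R"
        unfolding Q_def R_def
        by (subst prod.remove[OF _ k]) (auto intro!: prod.cong arg_cong2[where f = "(*)"])
      ultimately show ?thesis by (simp add: srw_pmf_Suc field_simps)
    qed
    have "?E n (\<lambda>ks. Q x (k # ks)) = (?E n (Q (x - axis k 1)) + ?E n (Q (x - axis k (-1)))) / 2"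
      unfolding Q_Cons by simp
    moreover have "P (x - axis k c) = ?E n (Q (x - axis k c))" for c
      by (rule P) (use False Suc.prems in \<open>simp add: axis_def\<close>)
    ultimately show ?thesis using False by (simp add: transverse_step_def)
  qed
  have "measure_pmf.prob (replicate_pmf (Suc n) (noise_pmf \<beta>)) {zs. sum_list (map transverse_step zs) = x} =
    measure_pmf.expectation (noise_pmf \<beta>) (\<lambda>z. P (x - transverse_step z))"
    by (simp add: prob_eq_expectation expectation_replicate_Suc P_def eq_diff_eq add.commute)
  also have "\<dots> = (\<Sum>k\<in>UNIV. ?E n (\<lambda>ks. Q x (k # ks))) / real CARD('d)"
    using step unfolding expectation_noise_pmf[OF assms(1,2)]
    by (simp add: field_simps sum_divide_distrib)
  also have "\<dots> = ?E (Suc n) (Q x)"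
    by (simp add: expectation_replicate_Suc integral_pmf_of_set)
  finally show ?case unfolding Q_def .
qed

text \<open>
  The return probability of each coordinate is at most \<open>1 / sqrt (m + 1)\<close>.  Jensen's
  inequality replaces the product of these square roots by a product of reciprocals, whose expectation
  is already known.
\<close>

theorem transverse_return_prob:
  assumes "0 \<le> \<beta>" "\<beta> \<le> 1"
  shows "measure_pmf.prob (replicate_pmf n (noise_pmf \<beta>)) {zs. sum_list (map transverse_step zs) = (0 :: int ^ 'd::{finite,one})}
    \<le> (real CARD('d) / (real n + 1)) powr ((real CARD('d) - 1) / 2)"
proof -
  let ?M = "replicate_pmf n (pmf_of_set (UNIV :: 'd set))"
  let ?K = "UNIV - {1 :: 'd}"
  define Z where "Z = (\<lambda>ks. \<Prod>k\<in>?K. 1 / sqrt (real (count (mset ks) k) + 1))"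
  define q where "q = real CARD('d) / (real n + 1)"
  have q: "0 < q" by (simp add: q_def)
  have cardK: "card ?K = CARD('d) - 1" by (simp add: card_Diff_singleton)
  have "measure_pmf.prob (replicate_pmf n (noise_pmf \<beta>)) {zs. sum_list (map transverse_step zs) = (0 :: (int, 'd) vec)} \<le>
      measure_pmf.expectation ?M Z"
    unfolding Z_def using assms
    by (simp add: prob_transverse_eq) (intro expectation_replicate_mono prod_mono conjI srw_pmf_nonneg srw_pmf_return_le)
  also have "\<dots> \<le> sqrt (measure_pmf.expectation ?M (\<lambda>ks. (Z ks)\<^sup>2))"
    using measure_pmf.variance_positive[of ?M Z] measure_pmf.variance_eq[of ?M Z]
    by (intro real_le_rsqrt) simp
  also have "measure_pmf.expectation ?M (\<lambda>ks. (Z ks)\<^sup>2) \<le> q ^ (CARD('d) - 1)"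
    using expectation_prod_inverse_counts[of n ?K]
    by (simp add: Z_def q_def cardK prod_power_distrib power_divide)
  also have "sqrt (q ^ (CARD('d) - 1)) = q powr ((real CARD('d) - 1) / 2)"
    using q by (simp add: powr_half_sqrt[symmetric] powr_realpow[symmetric] powr_powr of_nat_diff Suc_leI)
  finally show ?thesis by (simp add: q_def)
qed

section \<open>The excited walk as a function of independent noise\<close>

text \<open>
  The argument \<open>fr\<close> tells whether the current site is visited for the first time.
\<close>

definition erw_step :: "bool \<Rightarrow> 'd::{finite,one} noise \<Rightarrow> int ^ 'd::{finite,one}" where
  "erw_step fr z = (case z of (k, s, b) \<Rightarrow>
     if fr \<and> b \<and> k = 1 then axis 1 1 else axis k (if s then 1 else -1))"

text \<open>
  Both the noise list and the resulting path have the newest entry first, so dropping the first \<open>m\<close>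
  entries means going back \<open>m\<close> steps in time.
\<close>

primrec erw_path :: "'d::{finite,one} noise list \<Rightarrow> (int ^ 'd::{finite,one}) list" where
  "erw_path [] = [0]"
| "erw_path (z # zs) = (let ps = erw_path zs in (hd ps + erw_step (hd ps \<notin> set (tl ps)) z) # ps)"

definition erw_pos :: "'d::{finite,one} noise list \<Rightarrow> int ^ 'd::{finite,one}" where
  "erw_pos zs = hd (erw_path zs)"

definition fresh :: "'d::{finite,one} noise list \<Rightarrow> bool" where
  "fresh zs \<longleftrightarrow> erw_pos zs \<notin> set (tl (erw_path zs))"

lemma erw_path_Cons: "erw_path (z # zs) = (erw_pos zs + erw_step (fresh zs) z) # erw_path zs"
  by (simp add: Let_def erw_pos_def fresh_def)

lemma erw_pos_Nil [simp]: "erw_pos [] = 0"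
  by (simp add: erw_pos_def)

lemma erw_pos_Cons: "erw_pos (z # zs) = erw_pos zs + erw_step (fresh zs) z"
  by (simp add: erw_pos_def fresh_def Let_def)

lemma set_erw_path: "set (erw_path zs) = (\<lambda>j. erw_pos (drop j zs)) ` {..length zs}"
proof (induction zs)
  case (Cons z zs)
  show ?case
    by (simp add: atMost_Suc_eq_insert_0 erw_path_Cons Cons.IH erw_pos_Cons image_image del: erw_path.simps)
qed simp

lemma fresh_iff: "fresh zs \<longleftrightarrow> (\<forall>j. 0 < j \<and> j \<le> length zs \<longrightarrow> erw_pos (drop j zs) \<noteq> erw_pos zs)"
proof (cases zs)
  case Nil
  then show ?thesis by (auto simp: fresh_def)
next
  case (Cons z ws)
  have "set (tl (erw_path zs)) = (\<lambda>j. erw_pos (drop j zs)) ` Suc ` {..length ws}"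
    by (simp add: Cons erw_path_Cons set_erw_path image_image del: erw_path.simps)
  also have "Suc ` {..length ws} = {j. 0 < j \<and> j \<le> length zs}"
    by (auto simp: Cons image_Suc_atMost)
  finally show ?thesis unfolding fresh_def by (auto simp: image_iff)
qed

lemma fresh_drop_iff:
  assumes "i \<le> length zs"
  shows "fresh (drop i zs) \<longleftrightarrow>
    (\<forall>j. i < j \<and> j \<le> length zs \<longrightarrow> erw_pos (drop j zs) \<noteq> erw_pos (drop i zs))"
  unfolding fresh_iff
proof (intro iffI allI impI; elim conjE)
  fix j assume *: "\<forall>j. 0 < j \<and> j \<le> length (drop i zs) \<longrightarrow> erw_pos (drop j (drop i zs)) \<noteq> erw_pos (drop i zs)"
    and "i < j" "j \<le> length zs"
  then show "erw_pos (drop j zs) \<noteq> erw_pos (drop i zs)"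
    using *[rule_format, of "j - i"] by simp
next
  fix j assume *: "\<forall>j. i < j \<and> j \<le> length zs \<longrightarrow> erw_pos (drop j zs) \<noteq> erw_pos (drop i zs)"
    and "0 < j" "j \<le> length (drop i zs)"
  then show "erw_pos (drop j (drop i zs)) \<noteq> erw_pos (drop i zs)"
    using *[rule_format, of "i + j"] assms by (simp add: add.commute)
qed

lemma to_real_vec_add: "to_real_vec (x + y) = to_real_vec x + to_real_vec y"
  by (simp add: to_real_vec_def vec_eq_iff)

lemma to_real_vec_0 [simp]: "to_real_vec 0 = 0"
  by (simp add: to_real_vec_def vec_eq_iff)

lemma to_real_vec_axis: "to_real_vec (axis i s) = axis i (real_of_int s)"
  by (auto simp: to_real_vec_def vec_eq_iff axis_def)

lemma norm_erw_step: "norm (to_real_vec (erw_step fr z)) = 1"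
  by (auto simp: erw_step_def to_real_vec_axis norm_axis_1 split: prod.split)

lemma erw_step_drift:
  assumes "0 \<le> \<beta>" "\<beta> \<le> 1"
  shows "measure_pmf.expectation (noise_pmf \<beta> :: 'd::{finite,one} noise pmf) (\<lambda>z. to_real_vec (erw_step fr z)) =
    (\<beta> / real CARD('d) * of_bool fr) *\<^sub>R e1"
proof -
  have axis_minus: "axis k (-1) = - (axis k 1 :: (real, 'd) vec)" for k
    by (simp add: vec_eq_iff axis_def)
  have drift: "(\<beta> / 2) *\<^sub>R (to_real_vec (erw_step fr (k, True, True)) + to_real_vec (erw_step fr (k, False, True))) +
      ((1 - \<beta>) / 2) *\<^sub>R (to_real_vec (erw_step fr (k, True, False)) + to_real_vec (erw_step fr (k, False, False)))
    = (if k = 1 then (\<beta> * of_bool fr) *\<^sub>R e1 else 0)" for k :: 'd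
    by (cases "fr \<and> k = 1") (auto simp: erw_step_def to_real_vec_axis axis_minus e1_def simp flip: scaleR_2)
  show ?thesis
    unfolding expectation_noise_pmf[OF assms] drift by (simp add: field_simps)
qed

lemma prob_erw_step:
  fixes v :: "int ^ 'd::{finite,one}"
  assumes "0 \<le> \<beta>" "\<beta> \<le> 1"
  shows "measure_pmf.prob (noise_pmf \<beta>) {z. erw_step fr z = v} = step_prob (if fr then \<beta> else 0) v"
proof (cases "norm (to_real_vec v) = 1")
  case False
  then have "{z. erw_step fr z = v} = {}" using norm_erw_step by auto
  then show ?thesis using False by (simp only: measure_empty step_prob_def if_False)
next
  case True
  then obtain j :: 'd and s :: int where v: "v = axis j s" and s: "s = 1 \<or> s = -1"
    unfolding norm_to_real_vec_eq_1_iff by auto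
  have "(\<beta> / 2) *\<^sub>R (of_bool (erw_step fr (k, True, True) = v) + of_bool (erw_step fr (k, False, True) = v)) +
      ((1 - \<beta>) / 2) *\<^sub>R (of_bool (erw_step fr (k, True, False) = v) + of_bool (erw_step fr (k, False, False) = v))
    = (if k = j then (1 + (if fr then \<beta> else 0) * (if j = 1 then real_of_int s else 0)) / 2 else 0)" for k
    using s by (auto simp: erw_step_def v axis_eq_axis field_simps)
  moreover have "(e1 :: (real, 'd) vec) \<bullet> to_real_vec v = (if j = 1 then real_of_int s else 0)"
    by (simp add: e1_def v to_real_vec_axis inner_axis_axis)
  ultimately show ?thesis using True
    by (simp add: prob_eq_expectation expectation_noise_pmf[OF assms] step_prob_def field_simps)
qed

text \<open>
  The path up to time \<open>n\<close> as a list, newest entry first, to match the paths built from noise.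
\<close>

definition history :: "(nat \<Rightarrow> 'a) \<Rightarrow> nat \<Rightarrow> 'a list" where
  "history x n = map x (rev [0..<Suc n])"

lemma history_Suc: "history x (Suc n) = x (Suc n) # history x n"
  by (simp add: history_def)

lemma length_history [simp]: "length (history x n) = Suc n"
  by (simp add: history_def)

lemma nth_history: "i \<le> n \<Longrightarrow> history x n ! i = x (n - i)"
  by (simp add: history_def rev_map rev_nth del: upt_Suc)

lemma history_eq_iff: "history x n = history y n \<longleftrightarrow> (\<forall>i\<le>n. x i = y i)"
  by (auto simp: history_def map_eq_conv less_Suc_eq_le)

lemma prob_erw_path:
  fixes x :: "nat \<Rightarrow> int ^ 'd::{finite,one}"
  assumes "0 \<le> \<beta>" "\<beta> \<le> 1"
  shows "measure_pmf.prob (replicate_pmf n (noise_pmf \<beta>)) {zs. erw_path zs = history x n} =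
    (if x 0 = 0 then (\<Prod>i<n. erw_step_prob \<beta> i x (x (Suc i))) else 0)"
proof (induction n)
  case 0
  show ?case by (auto simp: prob_eq_expectation history_def)
next
  case (Suc n)
  have hist: "hd (history x n) = x n" "set (tl (history x n)) = x ` {..<n}"
    by (auto simp: history_def atLeast0LessThan)
  have "measure_pmf.prob (replicate_pmf (Suc n) (noise_pmf \<beta>)) {zs. erw_path zs = history x (Suc n)} =
    measure_pmf.expectation (replicate_pmf n (noise_pmf \<beta>)) (\<lambda>zs. of_bool (erw_path zs = history x n) *
      measure_pmf.prob (noise_pmf \<beta>) {z. erw_step (fresh zs) z = x (Suc n) - erw_pos zs})"
    unfolding prob_eq_expectation expectation_replicate_Suc_swap history_Suc erw_path_Cons list.inject
    by (simp add: of_bool_conj mult.commute eq_diff_eq add.commute)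
  also have "\<dots> = measure_pmf.expectation (replicate_pmf n (noise_pmf \<beta>)) (\<lambda>zs.
      of_bool (erw_path zs = history x n) * erw_step_prob \<beta> n x (x (Suc n)))"
  proof (intro Bochner_Integration.integral_cong refl)
    fix zs :: "'d noise list"
    show "of_bool (erw_path zs = history x n) *
        measure_pmf.prob (noise_pmf \<beta>) {z. erw_step (fresh zs) z = x (Suc n) - erw_pos zs} =
      of_bool (erw_path zs = history x n) * erw_step_prob \<beta> n x (x (Suc n))"
    proof (cases "erw_path zs = history x n")
      case True
      then have "erw_pos zs = x n" "fresh zs \<longleftrightarrow> \<not> (\<exists>j<n. x n = x j)"
        by (auto simp: erw_pos_def fresh_def hist)
      then show ?thesis
        by (cases "\<exists>j<n. x n = x j") (auto simp: prob_erw_step[OF assms] erw_step_prob_def)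
    qed simp
  qed
  also have "\<dots> = measure_pmf.prob (replicate_pmf n (noise_pmf \<beta>)) {zs. erw_path zs = history x n} *
      erw_step_prob \<beta> n x (x (Suc n))"
    by (simp add: prob_eq_expectation)
  finally show ?case by (simp add: Suc.IH)
qed

text \<open>
  Both laws live on a countable space, so it suffices to compare them on single paths, where
  the cylinder probabilities of the excited walk are known.
\<close>

lemma distr_erw_law_history:
  assumes "0 \<le> \<beta>" "\<beta> \<le> 1"
  shows "(\<lambda>\<omega>. history \<omega> n) \<in> measurable (erw_law \<beta>) (count_space (UNIV :: (int ^ 'd::{finite,one}) list set))"
    and "distr (erw_law \<beta>) (count_space UNIV) (\<lambda>\<omega>. history \<omega> n) =
      measure_pmf (map_pmf (erw_path :: 'd::{finite,one} noise list \<Rightarrow> _) (replicate_pmf n (noise_pmf \<beta>)))"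
proof -
  let ?M = "\<lambda>_::nat. count_space (UNIV :: (int, 'd) vec set)"
  interpret Ionescu_Tulcea "erw_kernel \<beta> :: nat \<Rightarrow> (nat \<Rightarrow> (int, 'd) vec) \<Rightarrow> _" ?M
    by (rule Ionescu_Tulcea_erw_kernel[OF assms])
  have sets: "sets (erw_law \<beta>) = sets (PiM UNIV ?M)"
    unfolding erw_law_def by simp
  have space: "space (erw_law \<beta>) = (UNIV :: (nat \<Rightarrow> (int, 'd) vec) set)"
    using sets_eq_imp_space_eq[OF sets] by (simp add: space_PiM)
  have cyl: "{\<omega>. history \<omega> n = l} = (if length l = Suc n then {\<omega>. \<forall>i\<le>n. \<omega> i = l ! (n - i)} else {})"
    for l :: "(int, 'd) vec list"
  proof (cases "length l = Suc n")
    case True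
    then have l: "l = history (\<lambda>i. l ! (n - i)) n"
      by (intro nth_equalityI) (auto simp: nth_history less_Suc_eq_le)
    have "history \<omega> n = l \<longleftrightarrow> (\<forall>i\<le>n. \<omega> i = l ! (n - i))" for \<omega>
      by (rule history_eq_iff[of _ n "\<lambda>i. l ! (n - i)", folded l])
    then show ?thesis using True by simp
  qed auto
  have comp: "{\<omega>. \<omega> i = y} \<in> sets (erw_law \<beta>)" for i and y :: "(int, 'd) vec"
  proof -
    have "(\<lambda>\<omega>. \<omega> i) \<in> measurable (PiM UNIV ?M) (count_space UNIV)"
      by (rule measurable_component_singleton) simp
    then have "(\<lambda>\<omega>. \<omega> i) -` {y} \<inter> space (PiM UNIV ?M) \<in> sets (PiM UNIV ?M)"
      by (rule measurable_sets) simp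
    then show ?thesis by (simp add: sets space_PiM vimage_def)
  qed
  show meas: "(\<lambda>\<omega>. history \<omega> n) \<in> measurable (erw_law \<beta>) (count_space (UNIV :: (int, 'd) vec list set))"
    unfolding measurable_count_space_eq2_countable
  proof (intro conjI ballI)
    fix l :: "(int, 'd) vec list"
    have "{\<omega>. \<forall>i\<le>n. \<omega> i = l ! (n - i)} = (\<Inter>i\<in>{..n}. {\<omega>. \<omega> i = l ! (n - i)})" by auto
    then have "{\<omega>. \<forall>i\<le>n. \<omega> i = l ! (n - i)} \<in> sets (erw_law \<beta>)"
      using comp by (simp only:) (intro sets.finite_INT, auto)
    then show "(\<lambda>\<omega>. history \<omega> n) -` {l} \<inter> space (erw_law \<beta>) \<in> sets (erw_law \<beta>)"
      using cyl[of l] by (simp add: vimage_def space)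
  qed simp
  show "distr (erw_law \<beta>) (count_space UNIV) (\<lambda>\<omega>. history \<omega> n) =
      measure_pmf (map_pmf (erw_path :: 'd noise list \<Rightarrow> _) (replicate_pmf n (noise_pmf \<beta>)))"
  proof (rule measure_eqI_countable)
    fix l :: "(int, 'd) vec list"
    let ?x = "\<lambda>i. l ! (n - i)"
    have R: "emeasure (measure_pmf (map_pmf (erw_path :: 'd noise list \<Rightarrow> _) (replicate_pmf n (noise_pmf \<beta>)))) {l} =
      ennreal (measure_pmf.prob (replicate_pmf n (noise_pmf \<beta>)) {zs. erw_path zs = l})"
      by (simp add: emeasure_pmf_single pmf_map vimage_def)
    have L: "emeasure (distr (erw_law \<beta>) (count_space UNIV) (\<lambda>\<omega>. history \<omega> n)) {l} =
      emeasure (erw_law \<beta>) {\<omega>. history \<omega> n = l}"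
      using meas by (simp add: emeasure_distr space vimage_def)
    show "emeasure (distr (erw_law \<beta>) (count_space UNIV) (\<lambda>\<omega>. history \<omega> n)) {l} =
      emeasure (measure_pmf (map_pmf (erw_path :: 'd noise list \<Rightarrow> _) (replicate_pmf n (noise_pmf \<beta>)))) {l}"
    proof (cases "length l = Suc n")
      case True
      then have l: "l = history ?x n"
        by (intro nth_equalityI) (auto simp: nth_history less_Suc_eq_le)
      have nonneg: "0 \<le> erw_step_prob \<beta> i ?x y" for i y
        using assms by (simp add: erw_step_prob_def step_prob_nonneg)
      have "emeasure (erw_law \<beta>) {\<omega>. history \<omega> n = l} =
        (if ?x 0 = 0 then (\<Prod>i<n. ennreal (erw_step_prob \<beta> i ?x (?x (Suc i)))) else 0)"
        using cyl[of l] True emeasure_erw_law_cylinder[OF assms, of n ?x] by simp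
      also have "\<dots> = ennreal (measure_pmf.prob (replicate_pmf n (noise_pmf \<beta>)) {zs. erw_path zs = history ?x n})"
        unfolding prob_erw_path[OF assms] by (simp add: prod_ennreal nonneg)
      finally show ?thesis unfolding L R by (simp only: l[symmetric])
    next
      case False
      have "length (erw_path zs) = Suc (length zs)" for zs :: "'d noise list"
        by (induction zs) (auto simp: Let_def)
      then have "measure_pmf.prob (replicate_pmf n (noise_pmf \<beta>)) {zs. erw_path zs = l} =
          measure_pmf.expectation (replicate_pmf n (noise_pmf \<beta> :: 'd noise pmf)) (\<lambda>_. 0 :: real)"
        unfolding prob_eq_expectation using False by (intro expectation_replicate_cong) auto
      then show ?thesis unfolding L R using cyl[of l] False by simp
    qed
  qed auto
qed

lemma distr_erw_law_position:
  assumes "0 \<le> \<beta>" "\<beta> \<le> 1"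
  shows "(\<lambda>\<omega>. \<omega> n) \<in> measurable (erw_law \<beta>) (count_space (UNIV :: (int ^ 'd::{finite,one}) set))"
    and "distr (erw_law \<beta>) (count_space UNIV) (\<lambda>\<omega>. \<omega> n) =
      measure_pmf (map_pmf (erw_pos :: 'd::{finite,one} noise list \<Rightarrow> _) (replicate_pmf n (noise_pmf \<beta>)))"
proof -
  have hd_hist: "(\<lambda>\<omega>. \<omega> n) = hd \<circ> (\<lambda>\<omega>. history \<omega> n)" for n :: nat
    by (auto simp: history_def)
  note H = distr_erw_law_history[OF assms, of n, where 'd = 'd]
  show "(\<lambda>\<omega>. \<omega> n) \<in> measurable (erw_law \<beta>) (count_space (UNIV :: (int, 'd) vec set))"
    unfolding hd_hist using H(1) by (rule measurable_comp) simp
  have "distr (erw_law \<beta>) (count_space (UNIV :: (int, 'd) vec set)) (\<lambda>\<omega>. \<omega> n) =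
      distr (distr (erw_law \<beta>) (count_space UNIV) (\<lambda>\<omega>. history \<omega> n)) (count_space UNIV) hd"
    unfolding hd_hist by (rule distr_distr[OF _ H(1), symmetric]) simp
  also have "\<dots> = measure_pmf (map_pmf erw_pos (replicate_pmf n (noise_pmf \<beta>)))"
    unfolding H(2) map_pmf_rep_eq[symmetric] map_pmf_comp erw_pos_def ..
  finally show "distr (erw_law \<beta>) (count_space UNIV) (\<lambda>\<omega>. \<omega> n) =
      measure_pmf (map_pmf (erw_pos :: 'd noise list \<Rightarrow> _) (replicate_pmf n (noise_pmf \<beta>)))" .
qed

lemma integral_erw_law_position:
  fixes f :: "int ^ 'd::{finite,one} \<Rightarrow> 'b::{banach, second_countable_topology}"
  assumes "0 \<le> \<beta>" "\<beta> \<le> 1"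
  shows "(\<integral>\<omega>. f (\<omega> n) \<partial>erw_law \<beta>) =
    measure_pmf.expectation (replicate_pmf n (noise_pmf \<beta>)) (\<lambda>zs. f (erw_pos zs))"
proof -
  have "(\<integral>\<omega>. f (\<omega> n) \<partial>erw_law \<beta>) = (\<integral>x. f x \<partial>distr (erw_law \<beta>) (count_space UNIV) (\<lambda>\<omega>. \<omega> n))"
    by (rule integral_distr[symmetric]) (auto intro: distr_erw_law_position[OF assms])
  also have "\<dots> = measure_pmf.expectation (replicate_pmf n (noise_pmf \<beta>)) (\<lambda>zs. f (erw_pos zs))"
    unfolding distr_erw_law_position(2)[OF assms] by simp
  finally show ?thesis .
qed

lemma measure_erw_law_position:
  fixes Q :: "int ^ 'd::{finite,one} \<Rightarrow> bool"
  assumes "0 \<le> \<beta>" "\<beta> \<le> 1"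
  shows "measure (erw_law \<beta>) {\<omega> \<in> space (erw_law \<beta>). Q (\<omega> n)} =
    measure_pmf.prob (replicate_pmf n (noise_pmf \<beta>)) {zs. Q (erw_pos zs)}"
proof -
  have "measure (erw_law \<beta>) {\<omega> \<in> space (erw_law \<beta>). Q (\<omega> n)} =
      measure (distr (erw_law \<beta>) (count_space UNIV) (\<lambda>\<omega>. \<omega> n)) {x. Q x}"
  proof -
    have "{\<omega> \<in> space (erw_law \<beta>). Q (\<omega> n)} = (\<lambda>\<omega>. \<omega> n) -` {x. Q x} \<inter> space (erw_law \<beta>)"
      by auto
    then show ?thesis
      by (simp only:) (rule measure_distr[symmetric], auto intro: distr_erw_law_position(1)[OF assms])
  qed
  then show ?thesis unfolding distr_erw_law_position(2)[OF assms] by (simp add: vimage_def)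
qed

section \<open>Decoupling the present from the past\<close>

text \<open>
  Projection along the first axis.  It maps the excited walk to the transverse walk.
\<close>

definition transverse :: "int ^ 'd::{finite,one} \<Rightarrow> int ^ 'd::{finite,one}" where
  "transverse x = (\<chi> i. if i = 1 then 0 else x $ i)"

lemma transverse_erw_pos: "transverse (erw_pos zs) = sum_list (map transverse_step zs)"
proof (induction zs)
  case Nil
  show ?case by (simp add: transverse_def vec_eq_iff)
next
  case (Cons z zs)
  have "transverse (erw_step fr z) = transverse_step z" for fr
    by (auto simp: transverse_def erw_step_def transverse_step_def vec_eq_iff axis_def split: prod.split)
  moreover have "transverse (x + y) = transverse x + transverse y" for x y :: "(int, 'a) vec"
    by (simp add: transverse_def vec_eq_iff)
  ultimately show ?case using Cons by (simp add: erw_pos_Cons add.commute)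
qed

text \<open>
  The argument \<open>dim\<close> only serves to fix the dimension, which enters through a type.
\<close>

locale excited_walk =
  fixes \<beta> :: real and dim :: "'d::{finite,one} itself"
  assumes \<beta>: "0 \<le> \<beta>" "\<beta> \<le> 1" and dim: "CARD('d) > 5"
begin

sublocale list_walk "noise_pmf \<beta> :: 'd noise pmf" transverse_step .

text \<open>
  Two sites with different projections are different.
\<close>

lemma erw_pos_neq_of_cut:
  assumes "cut_at zs t" "i \<le> t" "t < j" "j \<le> length zs"
  shows "erw_pos (drop i zs) \<noteq> erw_pos (drop j zs)"
proof
  assume "erw_pos (drop i zs) = erw_pos (drop j zs)"
  then have "sum_list (map transverse_step (drop i zs)) = sum_list (map transverse_step (drop j zs))"
    by (simp flip: transverse_erw_pos)
  moreover have "prefix_sum zs l + sum_list (map transverse_step (drop l zs)) = sum_list (map transverse_step zs)" for l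
    unfolding prefix_sum_def by (metis append_take_drop_id map_append sum_list_append)
  ultimately have "prefix_sum zs i = prefix_sum zs j"
    by (metis add_right_cancel)
  then show False using assms by (auto simp: cut_at_def)
qed

text \<open>
  The walk since the cut is a translate of a freshly started walk.  By induction on the
  time since the cut: a site is new for the whole walk if and only if it is new for the walk since the
  cut, since the sites visited before the cut are never met again; and then both walks take the same step.
\<close>

lemma restart_at_cut:
  assumes "cut_at zs t" "t \<le> length zs" "i \<le> t"
  shows "erw_pos (drop i zs) = erw_pos (drop i (take t zs)) + erw_pos (drop t zs) \<and>
         fresh (drop i zs) = fresh (drop i (take t zs))"
proof -
  let ?claim = "\<lambda>i. erw_pos (drop i zs) = erw_pos (drop i (take t zs)) + erw_pos (drop t zs)"
  have fresh_claim: "fresh (drop i zs) = fresh (drop i (take t zs))"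
    if i: "i \<le> t" and claim: "\<And>j. i \<le> j \<Longrightarrow> j \<le> t \<Longrightarrow> ?claim j" for i
  proof -
    have "fresh (drop i zs) \<longleftrightarrow> (\<forall>j. i < j \<and> j \<le> length zs \<longrightarrow> erw_pos (drop j zs) \<noteq> erw_pos (drop i zs))"
      by (rule fresh_drop_iff) (use i assms(2) in simp)
    also have "\<dots> \<longleftrightarrow> (\<forall>j. i < j \<and> j \<le> t \<longrightarrow> erw_pos (drop j zs) \<noteq> erw_pos (drop i zs))"
      using erw_pos_neq_of_cut[OF assms(1) i] assms(2) by (smt (verit) not_le order.trans)
    also have "\<dots> \<longleftrightarrow> (\<forall>j. i < j \<and> j \<le> t \<longrightarrow> erw_pos (drop j (take t zs)) \<noteq> erw_pos (drop i (take t zs)))"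
    proof -
      have "erw_pos (drop j zs) = erw_pos (drop i zs) \<longleftrightarrow>
          erw_pos (drop j (take t zs)) = erw_pos (drop i (take t zs))" if "i < j" "j \<le> t" for j
        by (simp only: claim[OF order.refl i] claim[OF less_imp_le[OF that(1)] that(2)] add_right_cancel)
      then show ?thesis by blast
    qed
    also have "\<dots> \<longleftrightarrow> fresh (drop i (take t zs))"
      by (subst fresh_drop_iff) (use i assms(2) in simp_all)
    finally show ?thesis .
  qed
  have "\<forall>j. i \<le> j \<and> j \<le> t \<longrightarrow> ?claim j"
    using assms(3)
  proof (induction i rule: inc_induct)
    case base
    then show ?case by auto
  next
    case (step i)
    have i: "i < length zs" "i < length (take t zs)" using step.hyps assms(2) by auto
    have nth: "take t zs ! i = zs ! i" using step.hyps by simp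
    have claim: "?claim (Suc i)" by (rule step.IH[rule_format]) (use step.hyps in simp)
    have fresh: "fresh (drop (Suc i) zs) = fresh (drop (Suc i) (take t zs))"
    proof (rule fresh_claim)
      show "Suc i \<le> t" using step.hyps by simp
      show "?claim j" if "Suc i \<le> j" "j \<le> t" for j
        by (rule step.IH[rule_format]) (use that in simp)
    qed
    have claim_i: "?claim i"
      unfolding Cons_nth_drop_Suc[OF i(1), symmetric] Cons_nth_drop_Suc[OF i(2), symmetric]
      by (simp only: erw_pos_Cons claim fresh nth add_ac)
    show ?case
    proof (intro allI impI)
      fix j assume j: "i \<le> j \<and> j \<le> t"
      show "?claim j"
      proof (cases "j = i")
        case True
        then show ?thesis using claim_i by (simp only:)
      next
        case False
        show ?thesis by (rule step.IH[rule_format]) (use j False in simp)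
      qed
    qed
  qed
  then show ?thesis using fresh_claim[OF assms(3)] assms(3) by blast
qed

text \<open>
  Both walks agree with the walk started at the cut.
\<close>

lemma fresh_eq_fresh_take:
  assumes "\<not> no_cut zs 0 m" "m \<le> length zs"
  shows "fresh zs \<longleftrightarrow> fresh (take m zs)"
proof -
  obtain t where t: "t < m" "cut_at zs t" using assms(1) by (auto simp: no_cut_def)
  have "fresh zs = fresh (take t zs)"
    using restart_at_cut[of zs t 0] t assms(2) by simp
  moreover have "cut_at (take m zs) t"
    using cut_window[of zs 0 t m] t assms(2) by simp
  then have "fresh (take m zs) = fresh (take t (take m zs))"
    using restart_at_cut[of "take m zs" t 0] t assms(2) by simp
  ultimately show ?thesis using t by (simp add: min_absorb1)
qed

definition rate :: real where "rate = min 1 ((real CARD('d) - 5) / 2)"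

lemma rate: "0 < rate" "rate \<le> 1"
  using dim by (auto simp: rate_def)

text \<open>
  The return probability has exponent \<open>(d - 1) / 2 = 2 + (d - 5) / 2\<close>, which is at least \<open>2 + rate\<close>.
\<close>

lemma no_cut_decay:
  obtains A where "A \<ge> 0" "\<And>L n a. a + L \<le> n \<Longrightarrow> Pr n (\<lambda>zs. no_cut zs a L) \<le> A * real (L + 1) powr -rate"
proof -
  define \<alpha> where "\<alpha> = (real CARD('d) - 1) / 2"
  have "return_prob k \<le> real CARD('d) powr \<alpha> * real (k + 1) powr (-2-rate)" for k
  proof -
    have "return_prob k \<le> (real CARD('d) / (real k + 1)) powr \<alpha>"
      unfolding return_prob_def \<alpha>_def by (rule transverse_return_prob[OF \<beta>])
    also have "\<dots> = real CARD('d) powr \<alpha> * real (k + 1) powr -\<alpha>"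
      by (simp add: divide_inverse powr_mult powr_minus inverse_powr add.commute)
    also have "real (k + 1) powr -\<alpha> \<le> real (k + 1) powr (-2-rate)"
      by (intro powr_mono) (auto simp: \<alpha>_def rate_def min_def field_simps)
    finally show ?thesis by (simp add: mult_left_mono)
  qed
  then obtain A where A: "\<And>L n a. a + L \<le> n \<Longrightarrow> Pr n (\<lambda>zs. no_cut zs a L) \<le> A * real (L + 1) powr -rate"
    using Pr_no_cut_decay rate by blast
  have "0 \<le> A" using A[of 0 0 0] by (auto intro: order.trans[rotated])
  then show ?thesis using A that by blast
qed

definition fresh_prob :: "nat \<Rightarrow> real" where
  "fresh_prob n = Pr n fresh"

lemma fresh_prob_bounds: "0 \<le> fresh_prob n" "fresh_prob n \<le> 1"
  by (simp_all add: fresh_prob_def)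

text \<open>
  An observable \<open>g\<close> of the past up to \<open>m\<close> steps ago is almost independent of the event that the
  present site is new.  The constant is recorded in a predicate since the same one serves
  for the mean and for the second moment.
\<close>

definition decoupling_bound :: "real \<Rightarrow> bool" where
  "decoupling_bound A \<longleftrightarrow> 0 \<le> A \<and> (\<forall>n m g G. m \<le> n \<longrightarrow> (\<forall>ys. length ys = n - m \<longrightarrow> \<bar>g ys\<bar> \<le> G) \<longrightarrow>
     \<bar>expct n (\<lambda>zs. g (drop m zs) * of_bool (fresh zs)) - expct (n - m) g * fresh_prob m\<bar>
       \<le> G * (A * real (m + 1) powr -rate))"

lemma decoupling_bound_nonneg: "decoupling_bound A \<Longrightarrow> 0 \<le> A"
  by (simp add: decoupling_bound_def)

lemma decoupling_boundD:
  assumes "decoupling_bound A" "m \<le> n" "\<And>ys. length ys = n - m \<Longrightarrow> \<bar>g ys\<bar> \<le> G"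
  shows "\<bar>expct n (\<lambda>zs. g (drop m zs) * of_bool (fresh zs)) - expct (n - m) g * fresh_prob m\<bar>
     \<le> G * (A * real (m + 1) powr -rate)"
  using assms by (simp add: decoupling_bound_def)

text \<open>
  Replace the newness of the present site by its newness for the walk driven by the last \<open>m\<close> noise
  variables.  The replacement is exactly independent of \<open>g\<close>, and it is wrong only if there is no
  cut time among the last \<open>m\<close> steps.
\<close>

lemma decoupling: "\<exists>A. decoupling_bound A"
proof -
  obtain A where A: "A \<ge> 0"
    "\<And>L n a. a + L \<le> n \<Longrightarrow> Pr n (\<lambda>zs. no_cut zs a L) \<le> A * real (L + 1) powr -rate"
    using no_cut_decay by metis
  have "decoupling_bound A"
    unfolding decoupling_bound_def
  proof (intro conjI A(1) allI impI)
    fix n m :: nat and g :: "'d noise list \<Rightarrow> real" and G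
    assume m: "m \<le> n" and g: "\<forall>ys. length ys = n - m \<longrightarrow> \<bar>g ys\<bar> \<le> G"
    have "\<bar>g (replicate (n - m) undefined)\<bar> \<le> G" using g by simp
    then have G: "0 \<le> G" by (rule order.trans[OF abs_ge_zero])
    have "expct (n - m) g * fresh_prob m = expct n (\<lambda>zs. g (drop m zs) * of_bool (fresh (take m zs)))"
      unfolding fresh_prob_def prob_eq_expectation
      using expectation_replicate_take_drop[OF m, of "noise_pmf \<beta>" "\<lambda>xs ys. g ys * of_bool (fresh xs)"]
      by (simp add: mult.commute)
    then have "\<bar>expct n (\<lambda>zs. g (drop m zs) * of_bool (fresh zs)) - expct (n - m) g * fresh_prob m\<bar> =
      \<bar>expct n (\<lambda>zs. g (drop m zs) * of_bool (fresh zs) - g (drop m zs) * of_bool (fresh (take m zs)))\<bar>"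
      by simp
    also have "\<dots> \<le> expct n (\<lambda>zs. \<bar>g (drop m zs) * of_bool (fresh zs) - g (drop m zs) * of_bool (fresh (take m zs))\<bar>)"
      by (rule integral_abs_bound)
    also have "\<dots> \<le> expct n (\<lambda>zs. G * of_bool (no_cut zs 0 m))"
      by (rule expectation_replicate_mono) (use fresh_eq_fresh_take m g G in \<open>auto simp: of_bool_def\<close>)
    also have "\<dots> = G * Pr n (\<lambda>zs. no_cut zs 0 m)"
      by (simp add: prob_eq_expectation)
    also have "\<dots> \<le> G * (A * real (m + 1) powr -rate)"
      using A(2)[of 0 m n] m G by (intro mult_left_mono) auto
    finally show "\<bar>expct n (\<lambda>zs. g (drop m zs) * of_bool (fresh zs)) - expct (n - m) g * fresh_prob m\<bar>
      \<le> G * (A * real (m + 1) powr -rate)" .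
  qed
  then show ?thesis ..
qed

text \<open>
  The asymptotic number of newly discovered sites per unit of time.
\<close>

definition fresh_density :: real where
  "fresh_density = lim fresh_prob"

lemma fresh_prob_diff_le:
  assumes "decoupling_bound A" "m \<le> n"
  shows "\<bar>fresh_prob n - fresh_prob m\<bar> \<le> A * real (m + 1) powr -rate"
  using decoupling_boundD[OF assms, of "\<lambda>_. 1" 1]
  by (simp add: fresh_prob_def prob_eq_expectation)

lemma fresh_prob_tendsto: "fresh_prob \<longlonglongrightarrow> fresh_density"
proof -
  obtain A where A: "decoupling_bound A" using decoupling by blast
  have lim0: "(\<lambda>m. A * real (m + 1) powr -rate) \<longlonglongrightarrow> 0"
    using rate by real_asymp
  have "Cauchy fresh_prob"
  proof (rule metric_CauchyI)
    fix e :: real assume "0 < e"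
    then obtain M where M: "A * real (M + 1) powr -rate < e / 2"
      using order_tendstoD(2)[OF lim0, of "e / 2"] by (auto simp: eventually_sequentially)
    have "dist (fresh_prob m) (fresh_prob n) < e" if "M \<le> m" "M \<le> n" for m n
      using fresh_prob_diff_le[OF A that(1)] fresh_prob_diff_le[OF A that(2)] M by (simp add: dist_real_def)
    then show "\<exists>M. \<forall>m\<ge>M. \<forall>n\<ge>M. dist (fresh_prob m) (fresh_prob n) < e" by blast
  qed
  then show ?thesis
    unfolding fresh_density_def by (simp add: Cauchy_convergent_iff convergent_LIMSEQ_iff)
qed

lemma fresh_density: "0 \<le> fresh_density" "fresh_density \<le> 1"
  using fresh_prob_bounds
  by (auto intro: LIMSEQ_le_const[OF fresh_prob_tendsto] LIMSEQ_le_const2[OF fresh_prob_tendsto])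

text \<open>
  The estimate between two times \<open>m \<le> n\<close> depends only on \<open>m\<close>, so it survives the limit in \<open>n\<close>.
\<close>

lemma fresh_prob_rate:
  assumes "decoupling_bound A"
  shows "\<bar>fresh_prob n - fresh_density\<bar> \<le> A * real (n + 1) powr -rate"
proof (rule LIMSEQ_le_const2)
  show "(\<lambda>k. \<bar>fresh_prob n - fresh_prob k\<bar>) \<longlonglongrightarrow> \<bar>fresh_prob n - fresh_density\<bar>"
    by (intro tendsto_intros fresh_prob_tendsto)
  show "\<exists>N. \<forall>k\<ge>N. \<bar>fresh_prob n - fresh_prob k\<bar> \<le> A * real (n + 1) powr -rate"
    using fresh_prob_diff_le[OF assms, of n] by (metis abs_minus_commute)
qed

section \<open>Mean and fluctuations of the position\<close>

abbreviation position :: "'d noise list \<Rightarrow> (real, 'd) vec" where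
  "position zs \<equiv> to_real_vec (erw_pos zs)"

lemma position_Cons: "position (z # zs) = position zs + to_real_vec (erw_step (fresh zs) z)"
  by (simp add: erw_pos_Cons to_real_vec_add)

lemma norm_position_diff: "norm (position zs - position (drop m zs)) \<le> real m"
proof (induction zs arbitrary: m)
  case (Cons z zs)
  show ?case
  proof (cases m)
    case (Suc m')
    have "norm (position (z # zs) - position (drop m (z # zs))) =
        norm ((position zs - position (drop m' zs)) + to_real_vec (erw_step (fresh zs) z))"
      by (simp add: Suc position_Cons algebra_simps)
    also have "\<dots> \<le> real m' + 1"
      by (rule norm_triangle_le) (simp add: Cons.IH norm_erw_step)
    finally show ?thesis using Suc by simp
  qed simp
qed simp

lemma norm_position_le: "norm (position zs) \<le> real (length zs)"
  using norm_position_diff[of zs "length zs"] by simp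

lemma integrable_noise [simp]:
  fixes f :: "'d noise \<Rightarrow> 'b::{banach, second_countable_topology}"
  shows "integrable (measure_pmf (noise_pmf \<beta>)) f"
  by (rule integrable_measure_pmf_finite) simp

definition fresh_drift :: real where "fresh_drift = \<beta> / real CARD('d)"

lemma fresh_drift_bounds: "0 \<le> fresh_drift" "fresh_drift \<le> 1"
  using \<beta> dim by (auto simp: fresh_drift_def divide_le_eq)

lemma expectation_erw_step: "measure_pmf.expectation (noise_pmf \<beta>) (\<lambda>z. to_real_vec (erw_step fr z) :: (real, 'd) vec) =
    (fresh_drift * of_bool fr) *\<^sub>R e1"
  unfolding fresh_drift_def by (rule erw_step_drift[OF \<beta>])

lemma mean_position:
  "measure_pmf.expectation (replicate_pmf n (noise_pmf \<beta>)) position =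
   (fresh_drift * (\<Sum>i<n. fresh_prob i)) *\<^sub>R e1"
proof (induction n)
  case (Suc n)
  have "measure_pmf.expectation (replicate_pmf (Suc n) (noise_pmf \<beta>)) position =
    measure_pmf.expectation (replicate_pmf n (noise_pmf \<beta>))
      (\<lambda>zs. position zs + (fresh_drift * of_bool (fresh zs)) *\<^sub>R e1)"
    unfolding expectation_replicate_Suc_swap position_Cons
    by (simp add: expectation_erw_step)
  also have "\<dots> = measure_pmf.expectation (replicate_pmf n (noise_pmf \<beta>)) position +
      (fresh_drift * fresh_prob n) *\<^sub>R e1"
    by (simp add: fresh_prob_def prob_eq_expectation)
  finally show ?case by (simp only: Suc.IH sum.lessThan_Suc distrib_left scaleR_add_left)
qed simp

definition velocity :: "(real, 'd) vec" where
  "velocity = (fresh_drift * fresh_density) *\<^sub>R e1"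

lemma norm_velocity: "norm velocity \<le> 1"
  using fresh_drift_bounds fresh_density by (simp add: velocity_def e1_def norm_axis_1 mult_le_one)

text \<open>
  The errors of the first-visit probabilities are summed with
  \<open>(i + 1) powr -rate \<le> n powr (1 - rate) / (i + 1)\<close>, which leaves a harmonic sum and hence the logarithm.
\<close>

lemma mean_position_rate:
  assumes "decoupling_bound A" and n: "0 < n"
  shows "norm (measure_pmf.expectation (replicate_pmf n (noise_pmf \<beta>)) position - real n *\<^sub>R velocity)
    \<le> A * (real n powr (1 - rate) * (1 + ln (real n)))"
proof -
  have A: "0 \<le> A" by (rule decoupling_bound_nonneg) fact
  have "measure_pmf.expectation (replicate_pmf n (noise_pmf \<beta>)) position - real n *\<^sub>R velocity =
      (fresh_drift * (\<Sum>i<n. fresh_prob i - fresh_density)) *\<^sub>R e1"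
    by (simp add: mean_position velocity_def sum_subtractf algebra_simps)
  then have "norm (measure_pmf.expectation (replicate_pmf n (noise_pmf \<beta>)) position - real n *\<^sub>R velocity) =
      fresh_drift * \<bar>\<Sum>i<n. fresh_prob i - fresh_density\<bar>"
    using fresh_drift_bounds by (simp add: abs_mult e1_def norm_axis_1)
  also have "\<dots> \<le> \<bar>\<Sum>i<n. fresh_prob i - fresh_density\<bar>"
    using fresh_drift_bounds by (simp add: mult_left_le_one_le)
  also have "\<dots> \<le> (\<Sum>i<n. A * real (i + 1) powr -rate)"
    by (intro order.trans[OF sum_abs] sum_mono fresh_prob_rate assms)
  also have "\<dots> \<le> (\<Sum>i<n. A * (real n powr (1 - rate) * inverse (real (i + 1))))"
  proof (intro sum_mono mult_left_mono A)
    fix i assume i: "i \<in> {..<n}"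
    have "real (i + 1) powr -rate = real (i + 1) powr (1 - rate) * real (i + 1) powr -1"
      by (simp only: powr_add[symmetric]) simp
    also have "real (i + 1) powr -1 = inverse (real (i + 1))" by (simp add: powr_minus)
    also have "real (i + 1) powr (1 - rate) * inverse (real (i + 1)) \<le> real n powr (1 - rate) * inverse (real (i + 1))"
      using i rate by (intro mult_right_mono powr_mono2) auto
    finally show "real (i + 1) powr -rate \<le> real n powr (1 - rate) * inverse (real (i + 1))" .
  qed
  also have "\<dots> = A * (real n powr (1 - rate) * harm n)"
    by (simp add: harm_def sum_distrib_left sum.atLeast1_atMost_eq)
  also have "\<dots> \<le> A * (real n powr (1 - rate) * (1 + ln (real n)))"
    using euler_mascheroni_sequence_decreasing[of 1 n] n A
    by (intro mult_left_mono) (auto simp: harm_def)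
  finally show ?thesis .
qed

text \<open>
  In the expansion of the square of the new deviation, the conditional mean of the increment of the deviation is
  \<open>fresh_drift * (of_bool (fresh zs) - fresh_density)\<close> in the first direction, and its length is at most 2.
\<close>

lemma second_moment_Suc:
  "expct (Suc n) (\<lambda>zs. (norm (position zs - real (Suc n) *\<^sub>R velocity))\<^sup>2) \<le>
    expct n (\<lambda>zs. (norm (position zs - real n *\<^sub>R velocity))\<^sup>2) + 4 +
    2 * fresh_drift * expct n (\<lambda>zs. ((position zs - real n *\<^sub>R velocity) \<bullet> e1) * (of_bool (fresh zs) - fresh_density))"
proof -
  have step: "measure_pmf.expectation (noise_pmf \<beta>) (\<lambda>z. (norm (position (z # zs) - real (Suc n) *\<^sub>R velocity))\<^sup>2) \<le>
      (norm (position zs - real n *\<^sub>R velocity))\<^sup>2 + 4 +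
      2 * fresh_drift * (((position zs - real n *\<^sub>R velocity) \<bullet> e1) * (of_bool (fresh zs) - fresh_density))" (is "?L \<le> ?R") for zs
  proof -
    define a where "a = position zs - real n *\<^sub>R velocity"
    define S where "S z = (to_real_vec (erw_step (fresh zs) z) :: (real, 'd) vec)" for z
    have "?L \<le> measure_pmf.expectation (noise_pmf \<beta>) (\<lambda>z. (norm a)\<^sup>2 + 4 + 2 * (a \<bullet> S z - a \<bullet> velocity))"
    proof (rule integral_mono)
      fix z :: "'d noise"
      have "norm (S z - velocity) \<le> 2"
        using norm_triangle_ineq4[of "S z" velocity] norm_velocity norm_erw_step[of "fresh zs" z] by (simp add: S_def)
      then have "(norm (S z - velocity))\<^sup>2 \<le> 2\<^sup>2" by (intro power_mono) auto
      moreover have "position (z # zs) - real (Suc n) *\<^sub>R velocity = a + (S z - velocity)"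
        by (simp add: position_Cons a_def S_def algebra_simps)
      moreover have "(norm (a + (S z - velocity)))\<^sup>2 = (norm a)\<^sup>2 + (norm (S z - velocity))\<^sup>2 + 2 * (a \<bullet> S z - a \<bullet> velocity)"
        by (simp add: power2_norm_eq_inner inner_add_left inner_add_right inner_diff_right inner_diff_left inner_commute)
      ultimately show "(norm (position (z # zs) - real (Suc n) *\<^sub>R velocity))\<^sup>2 \<le> (norm a)\<^sup>2 + 4 + 2 * (a \<bullet> S z - a \<bullet> velocity)"
        by simp
    qed auto
    also have "\<dots> = (norm a)\<^sup>2 + 4 + 2 * (a \<bullet> measure_pmf.expectation (noise_pmf \<beta>) S - a \<bullet> velocity)"
      by (simp add: integral_inner_right)
    also have "measure_pmf.expectation (noise_pmf \<beta>) S = (fresh_drift * of_bool (fresh zs)) *\<^sub>R e1"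
      unfolding S_def by (rule expectation_erw_step)
    also have "(norm a)\<^sup>2 + 4 + 2 * (a \<bullet> ((fresh_drift * of_bool (fresh zs)) *\<^sub>R e1) - a \<bullet> velocity) =
        (norm a)\<^sup>2 + 4 + 2 * fresh_drift * ((a \<bullet> e1) * (of_bool (fresh zs) - fresh_density))"
    proof -
      have "a \<bullet> velocity = fresh_drift * fresh_density * (a \<bullet> e1)" unfolding velocity_def by simp
      then show ?thesis by (simp add: algebra_simps)
    qed
    finally show ?thesis unfolding a_def .
  qed
  have "expct (Suc n) (\<lambda>zs. (norm (position zs - real (Suc n) *\<^sub>R velocity))\<^sup>2) \<le>
      expct n (\<lambda>zs. (norm (position zs - real n *\<^sub>R velocity))\<^sup>2 + 4 +
      2 * fresh_drift * (((position zs - real n *\<^sub>R velocity) \<bullet> e1) * (of_bool (fresh zs) - fresh_density)))"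
    unfolding expectation_replicate_Suc_swap by (intro integral_mono step) auto
  also have "\<dots> = expct n (\<lambda>zs. (norm (position zs - real n *\<^sub>R velocity))\<^sup>2) + 4 +
      2 * fresh_drift * expct n (\<lambda>zs. ((position zs - real n *\<^sub>R velocity) \<bullet> e1) * (of_bool (fresh zs) - fresh_density))"
    by simp
  finally show ?thesis .
qed

text \<open>
  The deviation changes by at most \<open>2 * m\<close> during the last \<open>m\<close> steps.  The deviation \<open>m\<close> steps ago
  is decoupled from the newness of the present site, whose probability is close to the density.
  If fewer than \<open>m\<close> steps have been made, the deviation itself is at most \<open>2 * m\<close>.
\<close>

lemma cross_term_bound:
  assumes dec: "decoupling_bound A"
  shows "expct n (\<lambda>zs. ((position zs - real n *\<^sub>R velocity) \<bullet> e1) * (of_bool (fresh zs) - fresh_density)) \<le>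
    2 * real m + 4 * real n * (A * real (m + 1) powr -rate)"
proof -
  define a where "a k zs = (position zs - real k *\<^sub>R velocity) \<bullet> e1" for k :: nat and zs
  define z where "z = A * real (m + 1) powr -rate"
  have z: "0 \<le> z" using decoupling_bound_nonneg[OF dec] by (simp add: z_def)
  have e1: "\<bar>v \<bullet> e1\<bar> \<le> norm v" for v :: "(real, 'd) vec"
    using Cauchy_Schwarz_ineq2[of v e1] by (simp add: e1_def norm_axis_1)
  have a_bound: "\<bar>a k zs\<bar> \<le> 2 * real k" if "length zs = k" for k zs
  proof -
    have "norm (position zs - real k *\<^sub>R velocity) \<le> norm (position zs) + norm (real k *\<^sub>R velocity)"
      by (rule norm_triangle_ineq4)
    also have "\<dots> \<le> real k + real k * 1"
      using norm_position_le[of zs] that norm_velocity by (intro add_mono) (auto intro: mult_left_le)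
    finally show ?thesis unfolding a_def using e1 order.trans by fastforce
  qed
  have fr: "\<bar>of_bool b - fresh_density\<bar> \<le> 1" for b using fresh_density by (cases b) auto
  show ?thesis
  proof (cases "m \<le> n")
    case False
    have "expct n (\<lambda>zs. a n zs * (of_bool (fresh zs) - fresh_density)) \<le> expct n (\<lambda>_. 2 * real m)"
    proof (rule expectation_replicate_mono)
      fix zs :: "'d noise list" assume "length zs = n"
      then have "\<bar>a n zs\<bar> * \<bar>of_bool (fresh zs) - fresh_density\<bar> \<le> 2 * real m * 1"
        using a_bound[of zs n] False by (intro mult_mono fr) auto
      then show "a n zs * (of_bool (fresh zs) - fresh_density) \<le> 2 * real m"
        by (simp add: abs_mult[symmetric])
    qed
    also have "\<dots> = 2 * real m" by simp
    finally have "expct n (\<lambda>zs. a n zs * (of_bool (fresh zs) - fresh_density)) \<le> 2 * real m" .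
    moreover have "0 \<le> 4 * real n * z" using z by simp
    ultimately show ?thesis unfolding a_def z_def by linarith
  next
    case True
    define g where "g = a (n - m)"
    have g: "\<bar>g ys\<bar> \<le> 2 * real n" if "length ys = n - m" for ys
      using a_bound[OF that] True by (simp add: g_def)
    have Eg: "\<bar>expct (n - m) g\<bar> \<le> 2 * real n"
    proof -
      have "\<bar>expct (n - m) g\<bar> \<le> expct (n - m) (\<lambda>ys. \<bar>g ys\<bar>)" by (rule integral_abs_bound)
      also have "\<dots> \<le> expct (n - m) (\<lambda>_. 2 * real n)" by (rule expectation_replicate_mono) (rule g)
      finally show ?thesis by simp
    qed
    have "expct n (\<lambda>zs. a n zs * (of_bool (fresh zs) - fresh_density)) \<le>
        expct n (\<lambda>zs. g (drop m zs) * of_bool (fresh zs) - fresh_density * g (drop m zs) + 2 * real m)"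
    proof (rule expectation_replicate_mono)
      fix zs :: "'d noise list"
      have "a n zs - g (drop m zs) = (position zs - position (drop m zs) - real m *\<^sub>R velocity) \<bullet> e1"
        using True by (simp add: a_def g_def of_nat_diff algebra_simps inner_diff_left)
      moreover have "norm (position zs - position (drop m zs) - real m *\<^sub>R velocity) \<le> real m + real m * 1"
        using norm_velocity norm_position_diff[of zs m]
        by (rule_tac order.trans[OF norm_triangle_ineq4], rule_tac add_mono) (auto intro: mult_left_le)
      ultimately have "\<bar>a n zs - g (drop m zs)\<bar> \<le> 2 * real m"
        using e1[of "position zs - position (drop m zs) - real m *\<^sub>R velocity"] by simp
      then have "\<bar>a n zs - g (drop m zs)\<bar> * \<bar>of_bool (fresh zs) - fresh_density\<bar> \<le> 2 * real m * 1"
        by (intro mult_mono fr) auto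
      then have "(a n zs - g (drop m zs)) * (of_bool (fresh zs) - fresh_density) \<le> 2 * real m"
        by (simp add: abs_mult[symmetric])
      then show "a n zs * (of_bool (fresh zs) - fresh_density) \<le>
          g (drop m zs) * of_bool (fresh zs) - fresh_density * g (drop m zs) + 2 * real m"
        by (simp add: algebra_simps)
    qed
    also have "\<dots> = expct n (\<lambda>zs. g (drop m zs) * of_bool (fresh zs)) - fresh_density * expct n (\<lambda>zs. g (drop m zs)) + 2 * real m"
      by simp
    also have "expct n (\<lambda>zs. g (drop m zs)) = expct (n - m) g"
      using expectation_replicate_take_drop[OF True, of "noise_pmf \<beta>" "\<lambda>xs. g"] by simp
    also have "expct n (\<lambda>zs. g (drop m zs) * of_bool (fresh zs)) \<le> expct (n - m) g * fresh_prob m + 2 * real n * z"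
      using decoupling_boundD[OF dec True, of g "2 * real n", OF g] unfolding z_def by (simp add: abs_le_iff)
    also have "expct (n - m) g * fresh_prob m + 2 * real n * z - fresh_density * expct (n - m) g + 2 * real m =
      expct (n - m) g * (fresh_prob m - fresh_density) + 2 * real n * z + 2 * real m" by (simp add: algebra_simps)
    also have "expct (n - m) g * (fresh_prob m - fresh_density) \<le> 2 * real n * z"
    proof -
      have "\<bar>expct (n - m) g\<bar> * \<bar>fresh_prob m - fresh_density\<bar> \<le> 2 * real n * z"
        using fresh_prob_rate[OF dec, of m] by (intro mult_mono Eg) (auto simp: z_def)
      then show ?thesis by (simp add: abs_mult[symmetric])
    qed
    finally show ?thesis unfolding a_def z_def by (simp add: algebra_simps)
  qed
qed

text \<open>
  The window length \<open>m\<close> is free.  Any choice \<open>m = m(n)\<close> that tends to infinity but is \<open>o(n)\<close> shows that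
  the second moment is \<open>o(n\<^sup>2)\<close>.
\<close>

lemma second_moment_bound:
  assumes dec: "decoupling_bound A"
  shows "expct n (\<lambda>zs. (norm (position zs - real n *\<^sub>R velocity))\<^sup>2) \<le>
    real n * (4 + 4 * real m) + 8 * (A * real (m + 1) powr -rate) * (real n)\<^sup>2"
proof (induction n)
  case (Suc n)
  define z where "z = A * real (m + 1) powr -rate"
  have z: "0 \<le> z" using decoupling_bound_nonneg[OF dec] by (simp add: z_def)
  have "2 * fresh_drift * expct n (\<lambda>zs. ((position zs - real n *\<^sub>R velocity) \<bullet> e1) * (of_bool (fresh zs) - fresh_density)) \<le>
      2 * fresh_drift * (2 * real m + 4 * real n * z)"
    using fresh_drift_bounds by (intro mult_left_mono cross_term_bound[OF dec, of n m, folded z_def]) auto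
  also have "\<dots> \<le> 2 * 1 * (2 * real m + 4 * real n * z)"
    using fresh_drift_bounds z by (intro mult_right_mono mult_left_mono) auto
  also have "\<dots> = 4 * real m + 8 * real n * z" by simp
  finally have cross': "2 * fresh_drift * expct n (\<lambda>zs. ((position zs - real n *\<^sub>R velocity) \<bullet> e1) * (of_bool (fresh zs) - fresh_density)) \<le>
      4 * real m + 8 * real n * z" .
  have "expct (Suc n) (\<lambda>zs. (norm (position zs - real (Suc n) *\<^sub>R velocity))\<^sup>2) \<le>
      expct n (\<lambda>zs. (norm (position zs - real n *\<^sub>R velocity))\<^sup>2) + 4 + (4 * real m + 8 * real n * z)"
    by (rule order.trans[OF second_moment_Suc add_left_mono[OF cross']])
  also have "\<dots> \<le> real n * (4 + 4 * real m) + 8 * z * (real n)\<^sup>2 + 4 + (4 * real m + 8 * real n * z)"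
    using Suc.IH unfolding z_def by simp
  also have "\<dots> \<le> real (Suc n) * (4 + 4 * real m) + 8 * z * (real (Suc n))\<^sup>2"
    using z by (simp add: algebra_simps power2_eq_square)
  finally show ?case unfolding z_def .
qed simp

lemma deviation_prob_le:
  assumes "0 < \<epsilon>" "0 < n"
  shows "Pr n (\<lambda>zs. dist (position zs /\<^sub>R real n) velocity > \<epsilon>) \<le>
    expct n (\<lambda>zs. (norm (position zs - real n *\<^sub>R velocity))\<^sup>2) / (real n * \<epsilon>)\<^sup>2"
proof -
  have "Pr n (\<lambda>zs. dist (position zs /\<^sub>R real n) velocity > \<epsilon>) \<le>
      expct n (\<lambda>zs. (norm (position zs - real n *\<^sub>R velocity))\<^sup>2 / (real n * \<epsilon>)\<^sup>2)"
    unfolding prob_eq_expectation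
  proof (rule expectation_replicate_mono)
    fix zs :: "'d noise list"
    have "position zs - real n *\<^sub>R velocity = real n *\<^sub>R (position zs /\<^sub>R real n - velocity)"
      using assms by (simp add: algebra_simps)
    then have "norm (position zs - real n *\<^sub>R velocity) = real n * dist (position zs /\<^sub>R real n) velocity"
      by (simp add: dist_norm)
    moreover have "(real n * \<epsilon>)\<^sup>2 \<le> (real n * dist (position zs /\<^sub>R real n) velocity)\<^sup>2"
      if "dist (position zs /\<^sub>R real n) velocity > \<epsilon>"
      using that assms by (intro power_mono mult_left_mono) auto
    ultimately show "of_bool (dist (position zs /\<^sub>R real n) velocity > \<epsilon>) \<le>
        (norm (position zs - real n *\<^sub>R velocity))\<^sup>2 / (real n * \<epsilon>)\<^sup>2"
      using assms by (auto simp: of_bool_def le_divide_eq)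
  qed
  then show ?thesis by simp
qed

lemma position_law_of_large_numbers:
  assumes \<epsilon>: "0 < \<epsilon>"
  shows "(\<lambda>n. Pr n (\<lambda>zs. dist (position zs /\<^sub>R real n) velocity > \<epsilon>)) \<longlonglongrightarrow> 0"
proof -
  obtain A where A: "decoupling_bound A" using decoupling by blast
  define h where "h n = ((4 + 4 * sqrt (real n)) / real n + 8 * (A * sqrt (real n) powr -rate)) / \<epsilon>\<^sup>2" for n
  have le: "Pr n (\<lambda>zs. dist (position zs /\<^sub>R real n) velocity > \<epsilon>) \<le> h n" if n: "0 < n" for n
  proof -
    \<comment> \<open>Any power of n with exponent strictly between 0 and 1 would do for the window length.\<close>
    define m where "m = nat \<lfloor>sqrt (real n)\<rfloor>"
    have m: "real m \<le> sqrt (real n)" "sqrt (real n) \<le> real (m + 1)"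
      by (auto simp: m_def) linarith+
    have "Pr n (\<lambda>zs. dist (position zs /\<^sub>R real n) velocity > \<epsilon>) \<le>
        (real n * (4 + 4 * real m) + 8 * (A * real (m + 1) powr -rate) * (real n)\<^sup>2) / (real n * \<epsilon>)\<^sup>2"
      by (rule order.trans[OF deviation_prob_le[OF \<epsilon> n]]) (intro divide_right_mono second_moment_bound[OF A], simp)
    also have "\<dots> = ((4 + 4 * real m) / real n + 8 * (A * real (m + 1) powr -rate)) / \<epsilon>\<^sup>2"
      using n \<epsilon> by (simp add: divide_simps power2_eq_square) (simp add: algebra_simps)
    also have "\<dots> \<le> h n"
      unfolding h_def using m decoupling_bound_nonneg[OF A] n rate
      by (intro divide_right_mono add_mono mult_left_mono powr_mono2') auto
    finally show ?thesis .
  qed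
  have "(\<lambda>n. (4 + 4 * sqrt (real n)) / real n) \<longlonglongrightarrow> 0" "(\<lambda>n. sqrt (real n) powr -rate) \<longlonglongrightarrow> 0"
    using rate by real_asymp+
  then have "(\<lambda>n. ((4 + 4 * sqrt (real n)) / real n + 8 * (A * sqrt (real n) powr -rate)) / \<epsilon>\<^sup>2)
      \<longlonglongrightarrow> (0 + 8 * (A * 0)) / \<epsilon>\<^sup>2"
    by (intro tendsto_divide tendsto_add tendsto_mult_left tendsto_const) (use \<epsilon> in auto)
  then have "h \<longlonglongrightarrow> 0" unfolding h_def by simp
  then show ?thesis
    by (rule Lim_null_comparison[rotated]) (use le in \<open>auto simp: eventually_sequentially intro!: exI[of _ 1]\<close>)
qed

end

section \<open>The law of large numbers\<close>

theorem theorem2p3: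
  assumes "CARD('d::{finite,one}) > 5"
  shows "\<exists>\<beta>0>0. \<forall>\<beta>. 0 \<le> \<beta> \<and> \<beta> \<le> 1 \<and> \<beta> \<le> \<beta>0 \<longrightarrow>
    (\<exists>\<theta> :: real ^ 'd::{finite,one}. (\<forall>i. i \<noteq> 1 \<longrightarrow> \<theta> $ i = 0) \<and>
      (\<lambda>n. norm ((\<integral>\<omega>. to_real_vec (\<omega> n) \<partial>erw_law \<beta>) - real n *\<^sub>R \<theta>))
        \<in> O(\<lambda>n. real n * (ln (real n) / real n powr min 1 ((real CARD('d::{finite,one}) - 5) / 2))) \<and>
      converges_in_prob (erw_law \<beta>) (\<lambda>n \<omega>. to_real_vec (\<omega> n) /\<^sub>R real n) \<theta>)"
\<comment> \<open>The transverse walk, and with it the cut times, has the same law for all excitement parameters in [0,1].\<close>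
proof (rule exI[of _ 1], intro conjI allI impI; (elim conjE)?)
  fix \<beta> :: real assume \<beta>: "0 \<le> \<beta>" "\<beta> \<le> 1"
  interpret excited_walk \<beta> "TYPE('d)"
    by unfold_locales (use \<beta> assms in auto)
  obtain A where A: "decoupling_bound A" using decoupling by blast
  have mean: "norm (norm ((\<integral>\<omega>. to_real_vec (\<omega> n) \<partial>erw_law \<beta>) - real n *\<^sub>R velocity)) \<le>
      2 * A * norm (real n * (ln (real n) / real n powr rate))" if "3 \<le> n" for n
  proof -
    have ln: "1 \<le> ln (real n)"
      using that exp_le by (subst ln_ge_iff) auto
    have "norm ((\<integral>\<omega>. to_real_vec (\<omega> n) \<partial>erw_law \<beta>) - real n *\<^sub>R velocity) \<le>
        A * (real n powr (1 - rate) * (1 + ln (real n)))"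
      unfolding integral_erw_law_position[OF \<beta>] using that by (intro mean_position_rate[OF A]) simp
    also have "\<dots> \<le> A * (real n powr (1 - rate) * (2 * ln (real n)))"
      using ln decoupling_bound_nonneg[OF A] by (simp add: mult_left_mono)
    also have "real n powr (1 - rate) = real n / real n powr rate"
      using that by (simp add: powr_diff)
    finally show ?thesis using ln by (simp add: algebra_simps)
  qed
  have bigo: "(\<lambda>n. norm ((\<integral>\<omega>. to_real_vec (\<omega> n) \<partial>erw_law \<beta>) - real n *\<^sub>R velocity))
        \<in> O(\<lambda>n. real n * (ln (real n) / real n powr rate))"
    by (intro bigoI[of _ "2 * A"] eventually_sequentiallyI[of 3] mean)
  have conv: "converges_in_prob (erw_law \<beta>) (\<lambda>n \<omega>. to_real_vec (\<omega> n) /\<^sub>R real n) velocity"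
    unfolding converges_in_prob_def
    using position_law_of_large_numbers measure_erw_law_position[OF \<beta>, of "\<lambda>x. dist (to_real_vec x /\<^sub>R real _) velocity > _"]
    by simp
  show "\<exists>\<theta> :: real ^ 'd::{finite,one}. (\<forall>i. i \<noteq> 1 \<longrightarrow> \<theta> $ i = 0) \<and>
      (\<lambda>n. norm ((\<integral>\<omega>. to_real_vec (\<omega> n) \<partial>erw_law \<beta>) - real n *\<^sub>R \<theta>))
        \<in> O(\<lambda>n. real n * (ln (real n) / real n powr min 1 ((real CARD('d::{finite,one}) - 5) / 2))) \<and>
      converges_in_prob (erw_law \<beta>) (\<lambda>n \<omega>. to_real_vec (\<omega> n) /\<^sub>R real n) \<theta>"
    using bigo conv unfolding rate_def
    by (intro exI[of _ velocity]) (auto simp: velocity_def e1_def axis_def)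
qed simp

end
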